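(* Let $k \ge 1$ be an integer, $r \ge 2$ a prime, and $n \ge rk$ an integer. Let $\mathcal{P} = \{P_1, \dots, P_\ell\}$ be a partition of $[n]$ with $|P_i| \le r-1$ for all $i$. Let $t\ge1$ be an integer with $t \le r(k-3)+2$. Then $$\chi(\mathrm{KG}^r(n,k;\mathcal{P})_{t\text{-wide}}) = \left\lceil \frac{n-r(k-1)}{r-1} \right\rceil.$$
   Context: For a hypergraph $H$, an $m$-coloring is a map from the vertices to $[m]$ such that no hyperedge is monochromatic; $\chi(H)$ is the least such $m$. A set $\sigma\subseteq[n]$ is called $t$-wide if it is not contained in any of the sets $\{i,i+1,\dots,i+t-1\}$ for $i\in[n-t+1]$. For a partition $\mathcal{P}=\{P_1,\dots,P_\ell\}$ of $[n]$, $\mathrm{KG}^r(n,k;\mathcal{P})_{t\text{-wide}}$ is the $r$-uniform hypergraph whose vertices are the $k$-element subsets $\sigma\subseteq[n]$ that are $t$-wide and satisfy $|\sigma\cap P_i|\le1$ for all $i$, and whose hyperedges are the collections of $r$ such sets that are pairwise disjoint. *)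

theory Defs
  imports Complex_Main "HOL-Library.Disjoint_Sets" "HOL-Computational_Algebra.Primes"
begin

type_synonym 'a hypergraph = "'a set \<times> 'a set set"

abbreviation hverts :: "'a hypergraph \<Rightarrow> 'a set" where
  "hverts H \<equiv> fst H"

abbreviation hedges :: "'a hypergraph \<Rightarrow> 'a set set" where
  "hedges H \<equiv> snd H"

definition monochromatic :: "('a \<Rightarrow> nat) \<Rightarrow> 'a set \<Rightarrow> bool" where
  "monochromatic c e \<longleftrightarrow> (\<exists>a. \<forall>v\<in>e. c v = a)"

definition is_coloring :: "'a hypergraph \<Rightarrow> nat \<Rightarrow> ('a \<Rightarrow> nat) \<Rightarrow> bool" where
  "is_coloring H m c \<longleftrightarrow>
     c ` hverts H \<subseteq> {1..m} \<and> (\<forall>e\<in>hedges H. \<not> monochromatic c e)"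

definition chromatic_number :: "'a hypergraph \<Rightarrow> nat" where
  "chromatic_number H = (LEAST m. \<exists>c. is_coloring H m c)"

text \<open>The condition \<open>i + t \<le> n + 1\<close> says \<open>i \<le> n - t + 1\<close> without truncated subtraction.\<close>

definition t_wide :: "nat \<Rightarrow> nat \<Rightarrow> nat set \<Rightarrow> bool" where
  "t_wide n t \<sigma> \<longleftrightarrow> (\<forall>i. 1 \<le> i \<and> i + t \<le> n + 1 \<longrightarrow> \<not> \<sigma> \<subseteq> {i..<i + t})"

definition KG_wide_verts :: "nat \<Rightarrow> nat \<Rightarrow> nat set set \<Rightarrow> nat \<Rightarrow> nat set set" where
  "KG_wide_verts n k P t =
     {\<sigma>. \<sigma> \<subseteq> {1..n} \<and> card \<sigma> = k \<and> t_wide n t \<sigma> \<and> (\<forall>p\<in>P. card (\<sigma> \<inter> p) \<le> 1)}"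

definition KG_wide :: "nat \<Rightarrow> nat \<Rightarrow> nat \<Rightarrow> nat set set \<Rightarrow> nat \<Rightarrow> nat set hypergraph" where
  "KG_wide r n k P t =
     (KG_wide_verts n k P t,
      {e. e \<subseteq> KG_wide_verts n k P t \<and> card e = r \<and> pairwise disjnt e})"

end

theory Submission
  imports Defs "Jordan_Normal_Form.Determinant" "HOL-Number_Theory.Cong"
begin

text \<open>
  Let \<open>p = r\<close>. A configuration is a family of \<open>p\<close> disjoint subsets (slices) of the ground set, each
  meeting every class of the partition at most once. The cyclic group of order \<open>p\<close> rotates the slices.
  The key fact is a Tucker lemma: for every equivariant map from configurations to the cyclic group
  there is a full chain of configurations, growing by one point at a time, along which consecutive
  signs differ.

  For classes of size exactly \<open>p - 1\<close> the configurations form a join of chessboard complexes, which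
  carries a fundamental cycle. Pairing this cycle modulo rotation with the pullback of the power of
  the cocycle \<open>alt\<close> gives a number modulo \<open>p\<close> that does not depend on the equivariant map. For
  the map that takes the label of the largest point, it is a power of \<open>(p - 1)!\<close>, hence nonzero. For
  smaller classes one adds dummy points.

  Given a coloring with \<open>C\<close> colors, the sign of a configuration with an admissible set in some slice
  is read off from the slices that attain the largest color. It changes at most \<open>(p - 1) C\<close> times.
  The sign of the remaining configurations is read off from the largest point while there are at
  most \<open>t\<close> points. After that it comes from the slices that begin at least \<open>t\<close> before the largest
  point, and once these are all slices, from the slices of width at least \<open>t\<close>. Unless all
  slices become wide, there are at most \<open>t + 2 (p - 1) \<le> p (k - 1)\<close> such configurations in the
  chain. If all slices are wide, each has at most \<open>k - 1\<close> points, so the bound \<open>p (k - 1)\<close> holds too.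
\<close>

section \<open>An alternating cocycle\<close>

text \<open>Composing a tuple with \<open>skip j\<close> deletes its entry at position
  \<open>j\<close>.\<close>

definition skip :: "nat \<Rightarrow> nat \<Rightarrow> nat" where
  "skip j i = (if i < j then i else Suc i)"

text \<open>For tuples of residues below \<open>p\<close> this is the sign of a permutation, and \<open>0\<close> if the tuple is
  not a permutation.\<close>

definition alt :: "nat \<Rightarrow> (nat \<Rightarrow> nat) \<Rightarrow> int" where
  "alt p v = det (mat p p (\<lambda>(i, c). if v i = c then 1 else 0))"

definition rho :: "nat \<Rightarrow> nat \<Rightarrow> nat" where
  "rho p j = Suc j mod p"

lemma rho_less: "p > 0 \<Longrightarrow> rho p j < p"
  by (simp add: rho_def)

lemma rho_eq_iff: "i < p \<Longrightarrow> j < p \<Longrightarrow> rho p i = rho p j \<longleftrightarrow> i = j"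
  by (auto simp: rho_def mod_Suc)

lemma bij_betw_rho:
  assumes "p > 0" shows "bij_betw (rho p) {..<p} {..<p}"
proof -
  have inj: "inj_on (rho p) {..<p}" by (auto simp: inj_on_def rho_eq_iff)
  moreover have "rho p ` {..<p} \<subseteq> {..<p}" using rho_less[OF assms] by auto
  ultimately show ?thesis
    by (simp add: bij_betw_def endo_inj_surj)
qed

lemma alt_cong: "(\<And>i. i < p \<Longrightarrow> v i = w i) \<Longrightarrow> alt p v = alt p w"
  unfolding alt_def by (intro arg_cong[where f = det] eq_matI) auto

lemma alt_eq_0:
  assumes "i < p" "j < p" "i \<noteq> j" "v i = v j"
  shows "alt p v = 0"
  unfolding alt_def
  by (rule det_identical_rows[of _ p i j]) (use assms in \<open>auto intro!: eq_vecI\<close>)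

lemma alt_swap:
  assumes "i < p" "j < p" "i \<noteq> j"
  shows "alt p (v(i := v j, j := v i)) = - alt p v"
proof -
  let ?A = "mat p p (\<lambda>(i, c). if v i = c then 1 else 0 :: int)"
  have "swaprows i j ?A = mat p p (\<lambda>(l, c). if (v(i := v j, j := v i)) l = c then 1 else 0)"
    using assms by (intro eq_matI) (auto simp: mat_swaprows_def)
  moreover have "det (swaprows i j ?A) = - det ?A"
    by (rule det_swaprows) (use assms in auto)
  ultimately show ?thesis unfolding alt_def by simp
qed

text \<open>Rotating the values permutes the columns of the matrix cyclically, and a
  \<open>p\<close>-cycle has sign (-1)^(p - 1).\<close>

lemma alt_rho:
  assumes p: "p > 0" and v: "\<And>i. i < p \<Longrightarrow> v i < p"
  shows "alt p (\<lambda>i. rho p (v i)) = (-1) ^ (p - 1) * alt p v"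
proof -
  define A where "A = mat p p (\<lambda>(i, c). if rho p (v i) = c then 1 else 0 :: int)"
  have A: "A \<in> carrier_mat (p - 1 + 1) (p - 1 + 1)" using p by (auto simp: A_def)
  have p': "p - 1 + 1 = p" using p by simp
  have rho_c: "(if c < p - 1 then c + 1 else c - (p - 1)) = rho p c" if "c < p" for c
    using that by (auto simp: rho_def mod_Suc)
  have "mat p p (\<lambda>(i, c). A $$ (i, if c < p - 1 then c + 1 else c - (p - 1)))
      = mat p p (\<lambda>(i, c). if v i = c then 1 else 0)"
  proof (intro eq_matI)
    fix i c assume "i < dim_row (mat p p (\<lambda>(i, c). if v i = c then 1 else 0 :: int))"
      "c < dim_col (mat p p (\<lambda>(i, c). if v i = c then 1 else 0 :: int))"
    then have "i < p" "c < p" by auto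
    then show "mat p p (\<lambda>(i, c). A $$ (i, if c < p - 1 then c + 1 else c - (p - 1))) $$ (i, c)
       = mat p p (\<lambda>(i, c). if v i = c then 1 else 0) $$ (i, c)"
      using rho_less[OF p, of c] v[of i] rho_eq_iff[of "v i" p c] rho_c[of c]
      by (simp add: A_def del: One_nat_def)
  qed auto
  then show ?thesis
    using det_swap_cols[OF A] unfolding p' alt_def A_def by simp
qed

text \<open>For odd \<open>p\<close> the sign in \<open>alt_rho\<close> is 1; for
  \<open>p = 2\<close> it is -1, which is 1 modulo 2.\<close>

lemma alt_rho_cong:
  assumes p: "prime p" and v: "\<And>i. i < p \<Longrightarrow> v i < p"
  shows "[alt p (\<lambda>i. rho p (v i)) = alt p v] (mod int p)"
proof (cases "p = 2")
  case True
  then show ?thesis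
    using alt_rho[of p v] v by (simp add: cong_iff_dvd_diff)
next
  case False
  then have "even (p - 1)"
    using p prime_odd_nat[of p] prime_ge_2_nat[OF p] by auto
  then show ?thesis
    using alt_rho[of p v] v prime_gt_0_nat[OF p] by simp
qed

text \<open>A permutation matrix is orthogonal, so its determinant is 1 or -1.\<close>

lemma alt_square:
  assumes "inj_on v {..<p}" "\<And>i. i < p \<Longrightarrow> v i < p"
  shows "alt p v * alt p v = 1"
proof -
  let ?A = "mat p p (\<lambda>(i, c). if v i = c then 1 else 0 :: int)"
  have "?A * transpose_mat ?A = 1\<^sub>m p"
  proof (intro eq_matI)
    fix i j assume "i < dim_row (1\<^sub>m p :: int mat)" "j < dim_col (1\<^sub>m p :: int mat)"
    then have ij: "i < p" "j < p" by auto
    have "(\<Sum>c = 0..<p. (if v i = c then 1 else 0) * (if v j = c then 1 else 0 :: int))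
       = (\<Sum>c = 0..<p. if c = v i then (if v j = c then 1 else 0 :: int) else 0)"
      by (intro sum.cong) auto
    also have "\<dots> = (if v j = v i then 1 else 0)"
      using assms(2)[OF ij(1)] by simp
    also have "\<dots> = (if i = j then 1 else 0)"
      using assms(1) ij by (auto simp: inj_on_def)
    finally show "(?A * transpose_mat ?A) $$ (i, j) = 1\<^sub>m p $$ (i, j)"
      using ij by (simp add: scalar_prod_def)
  qed auto
  moreover have "det (?A * transpose_mat ?A) = det ?A * det ?A"
    by (subst det_mult[of _ p]) (auto simp: det_transpose[of _ p])
  ultimately show ?thesis unfolding alt_def by simp
qed

text \<open>Expand along a column of ones, which is the sum of all the other columns.\<close>

lemma alt_cocycle:
  assumes v: "\<And>i. i \<le> p \<Longrightarrow> v i < p"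
  shows "(\<Sum>j\<le>p. (-1) ^ j * alt p (\<lambda>i. v (skip j i))) = 0"
proof -
  define A where "A = mat (Suc p) (Suc p)
    (\<lambda>(i, c). if c < p then (if v i = c then 1 else 0) else 1 :: int)"
  have A: "A \<in> carrier_mat (Suc p) (Suc p)" by (simp add: A_def)
  have "mat_delete A j p = mat p p (\<lambda>(i, c). if v (skip j i) = c then 1 else 0)"
    if "j \<le> p" for j
    using that by (intro eq_matI) (auto simp: A_def mat_delete_def skip_def)
  then have "A $$ (j, p) * cofactor A j p = (-1) ^ p * ((-1) ^ j * alt p (\<lambda>i. v (skip j i)))"
    if "j \<le> p" for j
    using that by (simp add: cofactor_def alt_def A_def power_add)
  then have 1: "det A = (-1) ^ p * (\<Sum>j\<le>p. (-1) ^ j * alt p (\<lambda>i. v (skip j i)))"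
    unfolding laplace_expansion_column[OF A lessI] sum_distrib_left
    by (intro sum.cong) auto
  define x where "x = vec (Suc p) (\<lambda>c. if c < p then 1 else - 1 :: int)"
  have "A *\<^sub>v x = 0\<^sub>v (Suc p)"
  proof (intro eq_vecI)
    fix i assume "i < dim_vec (0\<^sub>v (Suc p) :: int vec)"
    then have i: "i \<le> p" by simp
    have "(\<Sum>c = 0..<p. (if v i = c then 1 else 0 :: int)) = 1"
      using v[OF i] by simp
    then show "(A *\<^sub>v x) $ i = 0\<^sub>v (Suc p) $ i"
      using i by (simp add: A_def x_def scalar_prod_def)
  qed (simp add: A_def)
  moreover have "x \<noteq> 0\<^sub>v (Suc p)"
  proof
    assume "x = 0\<^sub>v (Suc p)"
    then have "x $ p = 0\<^sub>v (Suc p) $ p" by simp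
    then show False by (simp add: x_def)
  qed
  moreover have "x \<in> carrier_vec (Suc p)" by (simp add: x_def)
  ultimately have "det A = 0"
    using det_0_iff_vec_prod_zero[OF A] by blast
  then show ?thesis using 1 by simp
qed

text \<open>A power, with respect to the cup product, of the cocycle \<open>alt\<close>.\<close>

definition cup :: "nat \<Rightarrow> nat \<Rightarrow> (nat \<Rightarrow> nat) \<Rightarrow> int" where
  "cup p d y = (\<Prod>b<d. alt p (\<lambda>i. y (b * (p - 1) + i)))"

lemma block_le:
  fixes b d q i :: nat
  assumes "b < d" "i \<le> q" shows "b * q + i \<le> d * q"
proof -
  have "b * q + i \<le> Suc b * q" using assms by simp
  also have "\<dots> \<le> d * q" using assms by (intro mult_le_mono1) simp
  finally show ?thesis .
qed

lemma cup_cong: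
  assumes "\<And>i. i \<le> d * (p - 1) \<Longrightarrow> y i = z i"
  shows "cup p d y = cup p d z"
  unfolding cup_def
  by (intro prod.cong refl alt_cong assms block_le) auto

lemma cup_rho_cong:
  assumes p: "prime p" and v: "\<And>i. i \<le> d * (p - 1) \<Longrightarrow> y i < p"
  shows "[cup p d (\<lambda>i. rho p (y i)) = cup p d y] (mod int p)"
  unfolding cup_def
  by (intro cong_prod alt_rho_cong p v block_le) auto

text \<open>Neighbouring blocks share an endpoint, so two consecutive positions always lie in a
  common block, whose factor then vanishes.\<close>

lemma cup_eq_0:
  assumes "p \<ge> 2" "i < d * (p - 1)" "y i = y (Suc i)"
  shows "cup p d y = 0"
proof -
  let ?q = "p - 1"
  obtain b r where br: "i = b * ?q + r" "b < d" "r < ?q"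
    using assms by (metis div_mult_mod_eq less_mult_imp_div_less mod_less_divisor mult_0_right
        neq0_conv not_less0)
  have "alt p (\<lambda>i. y (b * ?q + i)) = 0"
    using br assms(3) by (intro alt_eq_0[of r p "Suc r"]) auto
  then show ?thesis using br unfolding cup_def by auto
qed

text \<open>This is the Leibniz rule for the coboundary. Deletions in the first \<open>d\<close>
  blocks are summed by the induction hypothesis, those in the last block by
  \<open>alt_cocycle\<close>, and what is left of the two parts cancels.\<close>

lemma cup_cocycle:
  assumes p: "p \<ge> 1" and "\<And>i. i \<le> Suc (d * (p - 1)) \<Longrightarrow> y i < p"
  shows "(\<Sum>j\<le>Suc (d * (p - 1)). (-1) ^ j * cup p d (\<lambda>i. y (skip j i))) = 0"
  using assms(2)
proof (induction d)
  case 0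
  then show ?case by (simp add: cup_def)
next
  case (Suc d)
  let ?q = "p - 1" let ?m = "d * ?q"
  let ?z = "\<lambda>i. y (?m + i)"
  let ?f = "\<lambda>j. (-1) ^ j * cup p (Suc d) (\<lambda>i. y (skip j i))"
  have cup_Suc: "cup p (Suc d) w = cup p d w * alt p (\<lambda>i. w (?m + i))" for w
    by (simp add: cup_def)
  \<comment> \<open>Whatever \<open>j\<close> is, a deletion up to position \<open>?m\<close> shifts
    the last block by one, so that \<open>?z\<close> loses its first entry.\<close>
  have low: "?f j = (-1) ^ j * cup p d (\<lambda>i. y (skip j i)) * alt p (\<lambda>i. ?z (skip 0 i))"
    if "j \<le> ?m" for j
    using that by (simp add: cup_Suc skip_def)
  \<comment> \<open>A deletion after \<open>?m\<close> keeps the first \<open>d\<close> blocks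
    intact. The index \<open>j = 0\<close> is left out because position \<open>?m\<close> is already
    counted in \<open>low\<close>.\<close>
  have high: "?f (?m + j) = (-1) ^ ?m * cup p d y * ((-1) ^ j * alt p (\<lambda>i. ?z (skip j i)))"
    if "j \<ge> 1" for j
  proof -
    have "cup p d (\<lambda>i. y (skip (?m + j) i)) = cup p d y"
      using that by (intro cup_cong) (simp add: skip_def)
    moreover have "y (skip (?m + j) (?m + i)) = ?z (skip j i)" for i by (simp add: skip_def)
    ultimately show ?thesis by (simp add: cup_Suc power_add)
  qed
  have "{..Suc (Suc d * ?q)} = {..?m} \<union> (\<lambda>j. ?m + j) ` {1..p}"
  proof -
    have "Suc (Suc d * ?q) = ?m + p" using p by simp
    moreover have "(\<lambda>j. ?m + j) ` {1..p} = {?m + 1..?m + p}" by simp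
    ultimately show ?thesis by auto
  qed
  then have "(\<Sum>j\<le>Suc (Suc d * ?q). ?f j) = (\<Sum>j\<le>?m. ?f j) + (\<Sum>j\<in>(\<lambda>j. ?m + j) ` {1..p}. ?f j)"
    by (simp only:) (rule sum.union_disjoint, auto)
  also have "(\<Sum>j\<in>(\<lambda>j. ?m + j) ` {1..p}. ?f j) = (\<Sum>j=1..p. ?f (?m + j))"
    by (subst sum.reindex) auto
  also have "\<dots> = (-1) ^ ?m * cup p d y * (\<Sum>j=1..p. (-1) ^ j * alt p (\<lambda>i. ?z (skip j i)))"
    unfolding sum_distrib_left using high by (intro sum.cong) auto
  also have "(\<Sum>j=1..p. (-1) ^ j * alt p (\<lambda>i. ?z (skip j i))) = - alt p (\<lambda>i. ?z (skip 0 i))"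
  proof -
    have "(\<Sum>j\<le>p. (-1) ^ j * alt p (\<lambda>i. ?z (skip j i))) = 0"
      using p by (intro alt_cocycle Suc.prems) simp
    then show ?thesis by (simp add: sum.atMost_shift atMost_atLeast0 sum.atLeast_Suc_atMost)
  qed
  also have "(\<Sum>j\<le>?m. ?f j) = (\<Sum>j\<le>?m. (-1) ^ j * cup p d (\<lambda>i. y (skip j i))) * alt p (\<lambda>i. ?z (skip 0 i))"
    unfolding sum_distrib_right using low by (intro sum.cong) auto
  also have "(\<Sum>j\<le>?m. (-1) ^ j * cup p d (\<lambda>i. y (skip j i))) = (-1) ^ ?m * cup p d y"
  proof -
    have "cup p d (\<lambda>i. y (skip (Suc ?m) i)) = cup p d y"
      by (rule cup_cong) (simp add: skip_def)
    then show ?thesis using Suc.IH Suc.prems by simp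
  qed
  finally show ?case by simp
qed

section \<open>Sums over full chains of configurations\<close>

definition rot :: "nat \<Rightarrow> ('a \<times> nat) set \<Rightarrow> ('a \<times> nat) set" where
  "rot p X = map_prod id (rho p) ` X"

text \<open>Disjoint slices are encoded as the graph of a nonempty partial function from points to
  slice indices. The condition that a slice meets each class at most once is stated separately, in
  the conclusion of \<open>tucker_partition\<close>.\<close>

definition config :: "nat \<Rightarrow> 'a set \<Rightarrow> ('a \<times> nat) set \<Rightarrow> bool" where
  "config p V X \<longleftrightarrow> X \<noteq> {} \<and> X \<subseteq> V \<times> {..<p} \<and> inj_on fst X"

lemma config_unique: "config p V X \<Longrightarrow> (x, v) \<in> X \<Longrightarrow> (x, w) \<in> X \<Longrightarrow> v = w"
  using inj_onD[of fst X "(x, v)" "(x, w)"] by (auto simp: config_def)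

definition equivariant :: "nat \<Rightarrow> 'a set \<Rightarrow> (('a \<times> nat) set \<Rightarrow> nat) \<Rightarrow> bool" where
  "equivariant p V s \<longleftrightarrow> (\<forall>X. config p V X \<longrightarrow> s X < p \<and> s (rot p X) = rho p (s X))"

text \<open>A configuration is a set of labelled points. The points are \<open>0\<close> and \<open>d\<close> blocks
  \<open>b * (p - 1) + 1, \<dots>, b * (p - 1) + (p - 1)\<close>. The label of \<open>0\<close> is fixed to be \<open>0\<close>,
  which picks one full chain from each rotation orbit.\<close>

definition chain :: "(nat \<Rightarrow> nat) \<Rightarrow> (nat \<Rightarrow> nat) \<Rightarrow> nat \<Rightarrow> (nat \<times> nat) set" where
  "chain \<pi> a l = (\<lambda>x. (x, a x)) ` \<pi> ` {..l}"

text \<open>A factor of the product is the sign of the block, completed to a permutation by the missing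
  label \<open>j\<close>, and is \<open>0\<close> if two points of the block have the same label.\<close>

definition weight :: "nat \<Rightarrow> nat \<Rightarrow> (nat \<Rightarrow> nat) \<Rightarrow> int" where
  "weight p d a = (\<Prod>b<d. \<Sum>j<p. alt p (\<lambda>i. if i = 0 then j else a (b * (p - 1) + i)))"

abbreviation labels :: "nat \<Rightarrow> nat \<Rightarrow> nat set" where
  "labels p x \<equiv> if x = 0 then {0} else {..<p}"

definition labellings :: "nat \<Rightarrow> nat \<Rightarrow> (nat \<Rightarrow> nat) set" where
  "labellings p m = PiE {..m} (labels p)"

text \<open>The pairing of a cochain with the fundamental cycle modulo rotation, in the barycentric
  subdivision: \<pi> is the order in which the points enter, and \<open>sign \<pi>\<close> is the
  orientation of the resulting simplex.\<close>

definition chain_sum :: "nat \<Rightarrow> nat \<Rightarrow> ((nat \<Rightarrow> (nat \<times> nat) set) \<Rightarrow> int) \<Rightarrow> int" where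
  "chain_sum p d \<Psi> = (\<Sum>\<pi> | \<pi> permutes {..d * (p - 1)}. \<Sum>a\<in>labellings p (d * (p - 1)).
     sign \<pi> * (weight p d a * \<Psi> (chain \<pi> a)))"

lemma finite_labellings: "finite (labellings p m)"
  unfolding labellings_def by (rule finite_PiE) auto

lemma labellings_less: "a \<in> labellings p m \<Longrightarrow> p > 0 \<Longrightarrow> x \<le> m \<Longrightarrow> a x < p"
  unfolding labellings_def by (fastforce dest: PiE_mem[of _ _ _ x] split: if_splits)

lemma labellings_0: "a \<in> labellings p m \<Longrightarrow> a 0 = 0"
  unfolding labellings_def by (drule PiE_mem[of _ _ _ 0]) auto

lemma config_chain:
  assumes "\<pi> permutes {..m}" "a \<in> labellings p m" "p > 0" "l \<le> m"
  shows "config p {..m} (chain \<pi> a l)"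
proof -
  have "\<pi> ` {..l} \<subseteq> {..m}"
    using permutes_in_image[OF assms(1)] assms(4) by fastforce
  moreover have "a x < p" if "x \<in> {..m}" for x using labellings_less[OF assms(2,3)] that by simp
  ultimately show ?thesis
    unfolding config_def chain_def by (auto simp: inj_on_def)
qed

text \<open>Only the member with index \<open>j\<close> depends on which of the points at positions
  \<open>j\<close> and \<open>Suc j\<close> enters first.\<close>

lemma chain_comp_transpose:
  assumes "l \<noteq> j"
  shows "chain (\<pi> \<circ> Transposition.transpose j (Suc j)) a l = chain \<pi> a l"
proof -
  have "Transposition.transpose j (Suc j) ` {..l} = {..l}"
    using assms by (intro transpose_image_eq) auto
  then show ?thesis
    unfolding chain_def image_comp[symmetric] by simp
qed

text \<open>Composition with the transposition is a sign-reversing involution, so the sum is its own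
  negative.\<close>

lemma sum_sign_transpose:
  fixes g :: "(nat \<Rightarrow> nat) \<Rightarrow> int"
  assumes "j < m" and g: "\<And>\<pi>. g (\<pi> \<circ> Transposition.transpose j (Suc j)) = g \<pi>"
  shows "(\<Sum>\<pi> | \<pi> permutes {..m}. sign \<pi> * g \<pi>) = 0"
proof -
  let ?t = "Transposition.transpose j (Suc j)"
  have t: "?t permutes {..m}" using assms by (intro permutes_swap_id) auto
  have tt: "(\<pi> \<circ> ?t) \<circ> ?t = \<pi>" for \<pi> :: "nat \<Rightarrow> nat" by (simp add: comp_assoc)
  have sg: "sign (\<pi> \<circ> ?t) = - sign \<pi>" if "\<pi> permutes {..m}" for \<pi>
  proof -
    have "permutation \<pi>" using that by (auto simp: permutation_permutes)
    then show ?thesis by (simp add: sign_compose permutation_swap_id sign_swap_id)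
  qed
  have "(\<Sum>\<pi> | \<pi> permutes {..m}. sign \<pi> * g \<pi>)
      = (\<Sum>\<pi> | \<pi> permutes {..m}. sign (\<pi> \<circ> ?t) * g (\<pi> \<circ> ?t))"
    by (rule sum.reindex_bij_witness[where i = "\<lambda>\<pi>. \<pi> \<circ> ?t" and j = "\<lambda>\<pi>. \<pi> \<circ> ?t"])
      (auto simp: tt permutes_compose[OF t])
  also have "\<dots> = - (\<Sum>\<pi> | \<pi> permutes {..m}. sign \<pi> * g \<pi>)"
    unfolding sum_negf[symmetric] by (intro sum.cong) (auto simp: sg g)
  finally show ?thesis by simp
qed

section \<open>Blocks and the cycle condition for the weights\<close>

lemma block_decomposition:
  fixes x d q :: nat
  assumes "1 \<le> x" "x \<le> d * q"
  obtains b i where "b < d" "1 \<le> i" "i \<le> q" "x = b * q + i"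
proof
  have q: "q > 0" using assms by (cases q) auto
  show "(x - 1) div q < d"
    using assms by (intro less_mult_imp_div_less) auto
  show "1 \<le> (x - 1) mod q + 1" by simp
  have "(x - 1) mod q < q" using q by simp
  then show "(x - 1) mod q + 1 \<le> q" by simp
  show "x = (x - 1) div q * q + ((x - 1) mod q + 1)"
    using assms div_mult_mod_eq[of "x - 1" q] by linarith
qed

lemma block_unique:
  fixes b b' i i' q :: nat
  assumes "1 \<le> i" "i \<le> q" "1 \<le> i'" "i' \<le> q" "b * q + i = b' * q + i'"
  shows "b = b'" "i = i'"
proof -
  have *: "(b * q + (i - 1)) div q = b" if "1 \<le> i" "i \<le> q" for b i
    using that by (cases i) auto
  have "(b * q + (i - 1)) div q = b" "(b' * q + (i' - 1)) div q = b'"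
    using *[of i b] *[of i' b'] assms by blast+
  moreover have "b * q + (i - 1) = b' * q + (i' - 1)" using assms by simp
  ultimately show "b = b'" by simp
  then show "i = i'" using assms by simp
qed

text \<open>In the factor of the block of \<open>x\<close>, exchanging the label \<open>v\<close>
  with the missing label \<open>j\<close> swaps two rows of the determinant. The double sum over
  \<open>v\<close> and \<open>j\<close> is therefore antisymmetric and vanishes.\<close>

lemma weight_marginal:
  assumes "1 \<le> x" "x \<le> d * (p - 1)"
  shows "(\<Sum>v<p. weight p d (a(x := v))) = 0"
proof -
  let ?q = "p - 1"
  obtain b k where bk: "b < d" "1 \<le> k" "k \<le> ?q" "x = b * ?q + k"
    using block_decomposition[OF assms] .
  define w where "w = (\<lambda>i. a (b * ?q + i))"
  let ?F = "\<lambda>c a. \<Sum>j<p. alt p (\<lambda>i. if i = 0 then j else a (c * ?q + i))"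
  have other: "?F c (a(x := v)) = ?F c a" if "c \<noteq> b" for c v
  proof (intro sum.cong refl alt_cong)
    fix j i assume "i < p"
    then show "(if i = 0 then j else (a(x := v)) (c * ?q + i)) = (if i = 0 then j else a (c * ?q + i))"
      using block_unique(1)[of i ?q k c b] bk that by fastforce
  qed
  have own: "?F b (a(x := v)) = (\<Sum>j<p. alt p (w(0 := j, k := v)))" for v
    using bk by (intro sum.cong refl alt_cong) (auto simp: w_def)
  have anti: "alt p (w(0 := v, k := j)) = - alt p (w(0 := j, k := v))" for v j
  proof -
    have "(w(0 := j, k := v))(0 := (w(0 := j, k := v)) k, k := (w(0 := j, k := v)) 0) = w(0 := v, k := j)"
      using bk by (intro ext) auto
    then show ?thesis using alt_swap[of 0 p k "w(0 := j, k := v)"] bk by auto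
  qed
  have zero: "(\<Sum>v<p. \<Sum>j<p. alt p (w(0 := j, k := v))) = 0"
  proof -
    have "(\<Sum>v<p. \<Sum>j<p. alt p (w(0 := j, k := v))) = (\<Sum>v<p. \<Sum>j<p. alt p (w(0 := v, k := j)))"
      by (rule sum.swap)
    also have "\<dots> = - (\<Sum>v<p. \<Sum>j<p. alt p (w(0 := j, k := v)))"
      unfolding sum_negf[symmetric] by (intro sum.cong refl anti)
    finally show ?thesis by simp
  qed
  have "weight p d (a(x := v)) = (\<Prod>c\<in>{..<d} - {b}. ?F c a) * (\<Sum>j<p. alt p (w(0 := j, k := v)))" for v
  proof -
    have "weight p d (a(x := v)) = ?F b (a(x := v)) * (\<Prod>c\<in>{..<d} - {b}. ?F c (a(x := v)))"
      unfolding weight_def using bk by (intro prod.remove) auto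
    also have "(\<Prod>c\<in>{..<d} - {b}. ?F c (a(x := v))) = (\<Prod>c\<in>{..<d} - {b}. ?F c a)"
      by (intro prod.cong refl other) auto
    finally show ?thesis by (simp only: own mult.commute)
  qed
  then have "(\<Sum>v<p. weight p d (a(x := v)))
      = (\<Prod>c\<in>{..<d} - {b}. ?F c a) * (\<Sum>v<p. \<Sum>j<p. alt p (w(0 := j, k := v)))"
    by (simp only: sum_distrib_left)
  then show ?thesis unfolding zero by simp
qed

text \<open>The missing label runs over all residues, so it can be rotated along with the labels of
  the block, and \<open>alt_rho_cong\<close> applies to each determinant.\<close>

lemma weight_rho_cong:
  assumes p: "prime p" and a: "\<And>x. 1 \<le> x \<Longrightarrow> x \<le> d * (p - 1) \<Longrightarrow> a x < p \<and> a' x = rho p (a x)"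
  shows "[weight p d a' = weight p d a] (mod int p)"
  unfolding weight_def
proof (intro cong_prod)
  fix b assume "b \<in> {..<d}"
  then have b: "b < d" by simp
  let ?q = "p - 1"
  have p0: "p > 0" using p by (simp add: prime_gt_0_nat)
  have x: "1 \<le> b * ?q + i" "b * ?q + i \<le> d * ?q" if "1 \<le> i" "i < p" for i
    using that block_le[of b d i ?q] b by auto
  have "(\<Sum>j<p. alt p (\<lambda>i. if i = 0 then j else a' (b * ?q + i)))
    = (\<Sum>j<p. alt p (\<lambda>i. if i = 0 then rho p j else a' (b * ?q + i)))"
    by (rule sum.reindex_bij_betw[OF bij_betw_rho[OF p0], symmetric])
  also have "\<dots> = (\<Sum>j<p. alt p (\<lambda>i. rho p (if i = 0 then j else a (b * ?q + i))))"
    using a x by (intro sum.cong refl alt_cong) auto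
  also have "[\<dots> = (\<Sum>j<p. alt p (\<lambda>i. if i = 0 then j else a (b * ?q + i)))] (mod int p)"
    using a x p by (intro cong_sum alt_rho_cong) auto
  finally show "[(\<Sum>j<p. alt p (\<lambda>i. if i = 0 then j else a' (b * ?q + i))) =
     (\<Sum>j<p. alt p (\<lambda>i. if i = 0 then j else a (b * ?q + i)))] (mod int p)" .
qed

lemma weight_nonzero_inj:
  assumes "weight p d a \<noteq> 0" "b < d"
  shows "inj_on (\<lambda>i. a (b * (p - 1) + i)) {1..p - 1}"
proof (rule inj_onI, rule ccontr)
  fix i i' assume i: "i \<in> {1..p - 1}" "i' \<in> {1..p - 1}" "a (b * (p - 1) + i) = a (b * (p - 1) + i')" "i \<noteq> i'"
  then have "alt p (\<lambda>i. if i = 0 then j else a (b * (p - 1) + i)) = 0" for j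
    by (intro alt_eq_0[of i p i']) auto
  then have "weight p d a = 0"
    unfolding weight_def using assms(2) by (intro prod_zero bexI[of _ b]) auto
  then show False using assms by simp
qed

text \<open>The map \<open>R\<close> carries each fibre of \<open>h\<close> onto the next one, so
  all \<open>p\<close> fibre sums are congruent.\<close>

lemma sum_free_orbits:
  fixes f :: "'b \<Rightarrow> int"
  assumes p: "p > 0" and L: "finite L" and R: "bij_betw R L L"
    and h: "\<And>a. a \<in> L \<Longrightarrow> h a < p \<and> h (R a) = rho p (h a)"
    and f: "\<And>a. a \<in> L \<Longrightarrow> [f (R a) = f a] (mod int p)"
  shows "int p dvd sum f L"
proof -
  define g where "g j = (\<Sum>a | a \<in> L \<and> h a = j. f a)" for j
  have bij: "bij_betw R {a \<in> L. h a = j} {a \<in> L. h a = rho p j}" if "j < p" for j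
    unfolding bij_betw_def
  proof
    show "inj_on R {a \<in> L. h a = j}"
      by (rule inj_on_subset[OF bij_betw_imp_inj_on[OF R]]) auto
    show "R ` {a \<in> L. h a = j} = {a \<in> L. h a = rho p j}"
    proof (intro equalityI subsetI)
      fix a assume "a \<in> {a \<in> L. h a = rho p j}"
      moreover then obtain a' where "a' \<in> L" "a = R a'"
        using bij_betw_imp_surj_on[OF R] by blast
      ultimately show "a \<in> R ` {a \<in> L. h a = j}"
        using h[of a'] rho_eq_iff[of "h a'" p j] that by auto
    qed (use R h in \<open>auto simp: bij_betw_def\<close>)
  qed
  have step: "[g (rho p j) = g j] (mod int p)" if "j < p" for j
  proof -
    have "g (rho p j) = (\<Sum>a | a \<in> L \<and> h a = j. f (R a))"
      unfolding g_def by (rule sum.reindex_bij_betw[OF bij[OF that], symmetric])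
    also have "[\<dots> = g j] (mod int p)"
      unfolding g_def by (intro cong_sum f) auto
    finally show ?thesis .
  qed
  have g0: "[g j = g 0] (mod int p)" if "j < p" for j
    using that
  proof (induction j)
    case (Suc j)
    then have "[g (Suc j) = g j] (mod int p)" using step[of j] by (simp add: rho_def)
    then show ?case using Suc by (auto intro: cong_trans)
  qed simp
  have "sum f L = (\<Sum>j<p. g j)"
    unfolding g_def using L h by (intro sum.group[symmetric]) auto
  also have "[\<dots> = (\<Sum>j<p. g 0)] (mod int p)"
    by (intro cong_sum g0) auto
  finally show ?thesis by (simp add: cong_dvd_iff)
qed

text \<open>The fundamental chain has zero boundary modulo \<open>p\<close>. If the ignored member
  is not the last, swapping two points of the order cancels the terms. If it is the last, then
  either the last point is not 0 and the sum over its label vanishes by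
  \<open>weight_marginal\<close>, or it is 0 and rotation acts freely on the remaining
  labels.\<close>

lemma chain_sum_cancel:
  assumes p: "prime p" and d: "d > 0" and j: "j \<le> d * (p - 1)"
    and indep: "\<And>c c'. (\<And>l. l \<le> d * (p - 1) \<Longrightarrow> l \<noteq> j \<Longrightarrow> c l = c' l) \<Longrightarrow> \<Psi> c = \<Psi> c'"
    and inv: "\<And>\<pi> a. \<pi> permutes {..d * (p - 1)} \<Longrightarrow> a \<in> labellings p (d * (p - 1)) \<Longrightarrow>
        [\<Psi> (\<lambda>l. rot p (chain \<pi> a l)) = \<Psi> (chain \<pi> a)] (mod int p)"
  shows "int p dvd chain_sum p d \<Psi>"
proof -
  define N where "N = d * (p - 1)"
  let ?L = "labellings p N"
  have p2: "p \<ge> 2" using p by (rule prime_ge_2_nat)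
  have N1: "1 \<le> N" using p2 d by (simp add: N_def)
  show ?thesis
  proof (cases "j = N")
    case False
    then have "j < N" using j by (simp add: N_def)
    have "\<Psi> (chain (\<pi> \<circ> Transposition.transpose j (Suc j)) a) = \<Psi> (chain \<pi> a)" for \<pi> a
      by (rule indep) (simp add: chain_comp_transpose)
    then have "(\<Sum>\<pi> | \<pi> permutes {..N}. sign \<pi> * (\<Sum>a\<in>?L. weight p d a * \<Psi> (chain \<pi> a))) = 0"
      by (intro sum_sign_transpose[OF \<open>j < N\<close>]) simp
    then show ?thesis unfolding chain_sum_def N_def[symmetric] by (simp add: sum_distrib_left)
  next
    case True
    have "int p dvd (\<Sum>a\<in>?L. weight p d a * \<Psi> (chain \<pi> a))" if \<pi>: "\<pi> permutes {..N}" for \<pi>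
    proof (cases "\<pi> N = 0")
      case False
      define x where "x = \<pi> N"
      have x: "1 \<le> x" "x \<le> N"
        using False permutes_in_image[OF \<pi>, of N] by (auto simp: x_def)
      let ?S = "{..N} - {x}"
      have S: "{..N} = insert x ?S" using x by auto
      have chain_upd: "chain \<pi> (a(x := v)) l = chain \<pi> a l" if "l < N" for a v l
        unfolding chain_def
      proof (rule image_cong)
        fix y assume "y \<in> \<pi> ` {..l}"
        then have "y \<noteq> x" using that inj_eq[OF permutes_inj[OF \<pi>]] by (auto simp: x_def)
        then show "(y, (a(x := v)) y) = (y, a y)" by simp
      qed simp
      have \<Psi>_upd: "\<Psi> (chain \<pi> (a(x := v))) = \<Psi> (chain \<pi> a)" for a v
        by (rule indep, rule chain_upd) (use True in \<open>simp add: N_def\<close>)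
      have L: "?L = (\<lambda>(v, g). g(x := v)) ` ({..<p} \<times> PiE ?S (labels p))"
        unfolding labellings_def by (subst S, subst PiE_insert_eq) (use x in auto)
      have inj: "inj_on (\<lambda>(v, g). g(x := v)) ({..<p} \<times> PiE ?S (labels p))"
        using inj_combinator[of x ?S "labels p"] x by auto
      have "(\<Sum>a\<in>?L. weight p d a * \<Psi> (chain \<pi> a))
          = (\<Sum>(v, g)\<in>{..<p} \<times> PiE ?S (labels p). weight p d (g(x := v)) * \<Psi> (chain \<pi> g))"
        unfolding L sum.reindex[OF inj]
        by (rule sum.cong[OF refl], clarify) (simp only: o_apply case_prod_conv \<Psi>_upd)
      also have "\<dots> = (\<Sum>g\<in>PiE ?S (labels p). (\<Sum>v<p. weight p d (g(x := v))) * \<Psi> (chain \<pi> g))"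
        unfolding sum.cartesian_product[symmetric] sum_distrib_right by (rule sum.swap)
      also have "\<dots> = 0"
        using weight_marginal[of x d p] x by (simp add: N_def)
      finally show ?thesis by simp
    next
      case zero: True
      \<comment> \<open>The label of 0 has to stay 0. Since the point 0 enters last, all earlier
        members of the chain are nevertheless rotated by \<open>R\<close>.\<close>
      define R where "R a = (\<lambda>y\<in>{..N}. if y = 0 then 0 else rho p (a y))" for a :: "nat \<Rightarrow> nat"
      have RL: "R a \<in> ?L" for a
        using rho_less[of p] p2 by (auto simp: R_def labellings_def)
      have L_less: "a y < p" if "a \<in> ?L" "y \<le> N" for a y
        using labellings_less[OF that(1) _ that(2)] p2 by simp
      have "inj_on R ?L"
      proof (rule inj_onI)
        fix a a' assume a: "a \<in> ?L" "a' \<in> ?L" "R a = R a'"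
        show "a = a'"
          using a(1,2) unfolding labellings_def
        proof (rule PiE_ext)
          fix y assume y: "y \<in> {..N}"
          have "R a y = R a' y" using a by simp
          then show "a y = a' y"
            using y L_less[OF a(1), of y] L_less[OF a(2), of y]
              labellings_0[OF a(1)] labellings_0[OF a(2)]
            by (cases "y = 0") (auto simp: R_def rho_eq_iff)
        qed
      qed
      then have R: "bij_betw R ?L ?L"
        using RL by (simp add: bij_betw_def endo_inj_surj finite_labellings image_subset_iff)
      \<comment> \<open>The label of the point 1 tells the elements of an orbit apart; this point
        exists because \<open>d > 0\<close>.\<close>
      show ?thesis
      proof (rule sum_free_orbits[OF _ finite_labellings R, where h = "\<lambda>a. a 1"])
        show "p > 0" using p2 by simp
        fix a assume a: "a \<in> ?L"
        show "a 1 < p \<and> R a 1 = rho p (a 1)"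
          using L_less[OF a N1] N1 by (simp add: R_def)
        have rot: "chain \<pi> (R a) l = rot p (chain \<pi> a l)" if "l < N" for l
        proof -
          have "R a (\<pi> i) = rho p (a (\<pi> i))" if "i \<le> l" for i
          proof -
            have "\<pi> i \<noteq> \<pi> N" using that \<open>l < N\<close> inj_eq[OF permutes_inj[OF \<pi>]] by auto
            moreover have "\<pi> i \<le> N" using permutes_in_image[OF \<pi>, of i] that \<open>l < N\<close> by simp
            ultimately show ?thesis using zero by (simp add: R_def)
          qed
          then show ?thesis
            unfolding chain_def rot_def image_image by (intro image_cong) auto
        qed
        have "\<Psi> (chain \<pi> (R a)) = \<Psi> (\<lambda>l. rot p (chain \<pi> a l))"
          by (rule indep, rule rot) (use True in \<open>simp add: N_def\<close>)
        then have "[\<Psi> (chain \<pi> (R a)) = \<Psi> (chain \<pi> a)] (mod int p)"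
          using inv[of \<pi> a] \<pi> a by (simp add: N_def)
        moreover have "[weight p d (R a) = weight p d a] (mod int p)"
          using p by (rule weight_rho_cong) (use L_less[OF a] in \<open>auto simp: R_def N_def\<close>)
        ultimately show "[weight p d (R a) * \<Psi> (chain \<pi> (R a)) = weight p d a * \<Psi> (chain \<pi> a)] (mod int p)"
          by (intro cong_mult)
      qed
    qed
    then show ?thesis
      unfolding chain_sum_def N_def[symmetric] sum_distrib_left[symmetric]
      by - (rule dvd_sum, rule dvd_mult, simp)
  qed
qed

section \<open>A Tucker lemma\<close>

lemma rot_config:
  assumes "config p V X" "p > 0" shows "config p V (rot p X)"
proof -
  have "inj_on fst (rot p X)"
    using assms unfolding config_def rot_def by (auto simp: inj_on_def)
  then show ?thesis
    using assms rho_less[of p] unfolding config_def rot_def by force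
qed

lemma chain_sum_linear:
  "chain_sum p d (\<lambda>c. \<Sum>j\<in>J. f j * \<Psi> j c) = (\<Sum>j\<in>J. f j * chain_sum p d (\<Psi> j))"
proof -
  let ?S = "{\<pi>. \<pi> permutes {..d * (p - 1)}}" and ?L = "labellings p (d * (p - 1))"
  let ?F = "\<lambda>\<pi> a j. f j * (sign \<pi> * (weight p d a * \<Psi> j (chain \<pi> a)))"
  have "chain_sum p d (\<lambda>c. \<Sum>j\<in>J. f j * \<Psi> j c) = (\<Sum>\<pi>\<in>?S. \<Sum>a\<in>?L. \<Sum>j\<in>J. ?F \<pi> a j)"
    unfolding chain_sum_def sum_distrib_left by (intro sum.cong refl) (simp only: mult.left_commute)
  also have "\<dots> = (\<Sum>\<pi>\<in>?S. \<Sum>j\<in>J. \<Sum>a\<in>?L. ?F \<pi> a j)"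
    by (rule sum.cong[OF refl], rule sum.swap)
  also have "\<dots> = (\<Sum>j\<in>J. \<Sum>\<pi>\<in>?S. \<Sum>a\<in>?L. ?F \<pi> a j)"
    by (rule sum.swap)
  finally show ?thesis unfolding chain_sum_def sum_distrib_left .
qed

lemma chain_sum_0:
  assumes "\<And>\<pi> a. \<pi> permutes {..d * (p - 1)} \<Longrightarrow> a \<in> labellings p (d * (p - 1)) \<Longrightarrow> \<Psi> (chain \<pi> a) = 0"
  shows "chain_sum p d \<Psi> = 0"
  unfolding chain_sum_def using assms by simp

text \<open>The two sums are the terms \<open>j = Suc m\<close> and \<open>j = m\<close> of the cocycle identity for the tuple that
  lists both \<open>s\<close> and \<open>s'\<close> at position \<open>m\<close>. Each remaining term ignores one member of the chain.\<close>

lemma chain_sum_step: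
  assumes p: "prime p" and d: "d > 0" and m: "m \<le> d * (p - 1)"
    and s: "equivariant p {..d * (p - 1)} s" and s': "equivariant p {..d * (p - 1)} s'"
  shows "[chain_sum p d (\<lambda>c. cup p d (\<lambda>l. if l < Suc m then s (c l) else s' (c l)))
    = chain_sum p d (\<lambda>c. cup p d (\<lambda>l. if l < m then s (c l) else s' (c l)))] (mod int p)"
proof -
  define N where "N = d * (p - 1)"
  have p0: "p > 0" using p by (simp add: prime_gt_0_nat)
  define y where "y c i = (if i \<le> m then s (c i) else s' (c (i - 1)))" for c :: "nat \<Rightarrow> (nat \<times> nat) set" and i
  define \<Psi> where "\<Psi> j c = cup p d (\<lambda>i. y c (skip j i))" for j c
  have y_eq: "y (chain \<pi> a) i < p \<and> y (\<lambda>l. rot p (chain \<pi> a l)) i = rho p (y (chain \<pi> a) i)"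
    if "\<pi> permutes {..N}" "a \<in> labellings p N" "i \<le> Suc N" for \<pi> a i
  proof -
    have "config p {..N} (chain \<pi> a i)" if "i \<le> N" for i
      using config_chain that \<open>\<pi> permutes {..N}\<close> \<open>a \<in> labellings p N\<close> p0 by blast
    then show ?thesis
      using s s' m that(3) unfolding y_def equivariant_def N_def[symmetric] by auto
  qed
  have "chain_sum p d (\<lambda>c. \<Sum>j\<le>Suc N. (-1) ^ j * \<Psi> j c) = 0"
    unfolding \<Psi>_def N_def by (intro chain_sum_0 cup_cocycle) (use p0 y_eq in \<open>auto simp: N_def\<close>)
  then have sum0: "(\<Sum>j\<le>Suc N. (-1) ^ j * chain_sum p d (\<Psi> j)) = 0"
    by (simp only: chain_sum_linear)
  have cancel: "int p dvd chain_sum p d (\<Psi> j)" if j: "j \<le> Suc N" "j \<noteq> m" "j \<noteq> Suc m" for j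
  \<comment> \<open>Position \<open>m\<close> is doubled in the tuple, so beyond it entry
    \<open>j\<close> comes from member \<open>j - 1\<close>. Deleting the entry removes the only use
    of that member.\<close>
  proof (rule chain_sum_cancel[OF p d, where j = "if j < m then j else j - 1"])
    show "(if j < m then j else j - 1) \<le> d * (p - 1)" using j m by (auto simp: N_def)
    show "\<Psi> j c = \<Psi> j c'" if "\<And>l. l \<le> d * (p - 1) \<Longrightarrow> l \<noteq> (if j < m then j else j - 1) \<Longrightarrow> c l = c' l" for c c'
      unfolding \<Psi>_def
    proof (rule cup_cong)
      fix i assume i: "i \<le> d * (p - 1)"
      show "y c (skip j i) = y c' (skip j i)"
        using j m i by (auto simp: y_def skip_def N_def intro!: arg_cong[where f = s] arg_cong[where f = s'] that split: if_splits)
    qed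
    show "[\<Psi> j (\<lambda>l. rot p (chain \<pi> a l)) = \<Psi> j (chain \<pi> a)] (mod int p)"
      if "\<pi> permutes {..d * (p - 1)}" "a \<in> labellings p (d * (p - 1))" for \<pi> a
    proof -
      have skip: "skip j i \<le> Suc N" if "i \<le> d * (p - 1)" for i
        using that by (auto simp: skip_def N_def)
      have "\<Psi> j (\<lambda>l. rot p (chain \<pi> a l)) = cup p d (\<lambda>i. rho p (y (chain \<pi> a) (skip j i)))"
        unfolding \<Psi>_def by (rule cup_cong) (use y_eq that skip in \<open>auto simp: N_def\<close>)
      also have "[\<dots> = \<Psi> j (chain \<pi> a)] (mod int p)"
        unfolding \<Psi>_def by (rule cup_rho_cong[OF p]) (use y_eq that skip in \<open>auto simp: N_def\<close>)
      finally show ?thesis .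
    qed
  qed
  have m1: "\<Psi> m = (\<lambda>c. cup p d (\<lambda>l. if l < m then s (c l) else s' (c l)))"
    unfolding \<Psi>_def by (intro ext arg_cong[where f = "cup p d"]) (auto simp: y_def skip_def)
  have m2: "\<Psi> (Suc m) = (\<lambda>c. cup p d (\<lambda>l. if l < Suc m then s (c l) else s' (c l)))"
    unfolding \<Psi>_def by (intro ext arg_cong[where f = "cup p d"]) (auto simp: y_def skip_def)
  let ?g = "\<lambda>j. (-1) ^ j * chain_sum p d (\<Psi> j)"
  have "(\<Sum>j\<le>Suc N. ?g j) = (\<Sum>j\<in>{m, Suc m}. ?g j) + (\<Sum>j\<in>{..Suc N} - {m, Suc m}. ?g j)"
  proof -
    have "{m, Suc m} \<subseteq> {..Suc N}" using m by (auto simp: N_def)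
    then show ?thesis by (subst sum.subset_diff) (simp_all only: finite_atMost add.commute)
  qed
  moreover have "int p dvd (\<Sum>j\<in>{..Suc N} - {m, Suc m}. ?g j)"
    by (intro dvd_sum dvd_mult cancel) auto
  moreover from calculation(1) sum0
  have "(\<Sum>j\<in>{m, Suc m}. ?g j) = - (\<Sum>j\<in>{..Suc N} - {m, Suc m}. ?g j)" by linarith
  ultimately have "int p dvd (\<Sum>j\<in>{m, Suc m}. ?g j)" by (simp only: dvd_minus_iff)
  \<comment> \<open>The two surviving terms carry opposite signs.\<close>
  then have "int p dvd (-1) ^ m * (chain_sum p d (\<Psi> m) - chain_sum p d (\<Psi> (Suc m)))"
    by (simp add: algebra_simps)
  then have "int p dvd chain_sum p d (\<Psi> m) - chain_sum p d (\<Psi> (Suc m))"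
    by (cases "even m") (simp_all add: dvd_diff_commute)
  then have "[chain_sum p d (\<Psi> m) = chain_sum p d (\<Psi> (Suc m))] (mod int p)"
    by (simp add: cong_iff_dvd_diff)
  then show ?thesis unfolding m1 m2 by (rule cong_sym)
qed

text \<open>The map \<open>s\<close> is exchanged for \<open>s'\<close> one chain position at a
  time.\<close>

lemma chain_sum_equivariant_cong:
  assumes p: "prime p" and d: "d > 0"
    and s: "equivariant p {..d * (p - 1)} s" and s': "equivariant p {..d * (p - 1)} s'"
  shows "[chain_sum p d (\<lambda>c. cup p d (\<lambda>l. s (c l))) = chain_sum p d (\<lambda>c. cup p d (\<lambda>l. s' (c l)))] (mod int p)"
proof -
  let ?T = "\<lambda>m. chain_sum p d (\<lambda>c. cup p d (\<lambda>l. if l < m then s (c l) else s' (c l)))"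
  have "[?T m = ?T 0] (mod int p)" if "m \<le> Suc (d * (p - 1))" for m
    using that
  proof (induction m)
    case (Suc m)
    then show ?case using chain_sum_step[OF p d _ s s', of m] by (auto intro: cong_trans)
  qed simp
  from this[of "Suc (d * (p - 1))"]
  have "[?T (Suc (d * (p - 1))) = ?T 0] (mod int p)" by blast
  moreover have "?T (Suc (d * (p - 1))) = chain_sum p d (\<lambda>c. cup p d (\<lambda>l. s (c l)))"
    by (intro arg_cong[where f = "chain_sum p d"] ext cup_cong) simp
  ultimately show ?thesis by simp
qed

section \<open>Evaluation at the label of the largest point\<close>

definition top_label :: "(nat \<times> nat) set \<Rightarrow> nat" where
  "top_label X = (THE v. (Max (fst ` X), v) \<in> X)"

lemma config_the_label:
  assumes "config p V X" "(x, v) \<in> X"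
  shows "(THE v. (x, v) \<in> X) = v"
  using assms by (auto intro!: the_equality dest: config_unique)

lemma config_finite:
  "config p V X \<Longrightarrow> finite V \<Longrightarrow> finite X"
  unfolding config_def by (meson finite_SigmaI finite_lessThan finite_subset)

lemma fst_rot: "fst ` rot p X = fst ` X"
  by (force simp: rot_def)

lemma equivariant_top_label:
  assumes "p > 0" "finite V"
  shows "equivariant p V top_label"
  unfolding equivariant_def
proof (intro allI impI)
  fix X assume X: "config p V X"
  have "finite X" using config_finite[OF X assms(2)] .
  then have "Max (fst ` X) \<in> fst ` X" using X by (intro Max_in) (auto simp: config_def)
  then obtain v where v: "(Max (fst ` X), v) \<in> X" by force
  then have "(Max (fst ` rot p X), rho p v) \<in> rot p X"
    unfolding fst_rot by (force simp: rot_def)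
  then have "top_label (rot p X) = rho p v"
    unfolding top_label_def by (rule config_the_label[OF rot_config[OF X assms(1)]])
  moreover have "top_label X = v"
    unfolding top_label_def using config_the_label[OF X v] .
  moreover have "v < p" using X v by (auto simp: config_def)
  ultimately show "top_label X < p \<and> top_label (rot p X) = rho p (top_label X)" by simp
qed

lemma top_label_chain:
  assumes "\<pi> permutes {..m}" "a \<in> labellings p m" "p > 0" "l \<le> m"
  shows "top_label (chain \<pi> a l) = a (Max (\<pi> ` {..l}))"
proof -
  have 1: "fst ` chain \<pi> a l = \<pi> ` {..l}" by (force simp: chain_def)
  have "Max (\<pi> ` {..l}) \<in> \<pi> ` {..l}" by (rule Max_in) auto
  then have "(Max (\<pi> ` {..l}), a (Max (\<pi> ` {..l}))) \<in> chain \<pi> a l"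
    by (auto simp: chain_def)
  then show ?thesis
    unfolding top_label_def 1 using config_the_label[OF config_chain[OF assms]] by blast
qed

text \<open>If the running maxima increased strictly up to \<open>m\<close>, descending from the
  last one would give \<open>\<pi> l \<le> l\<close> for all \<open>l\<close>, which forces the
  identity.\<close>

lemma permutes_running_max:
  assumes \<pi>: "\<pi> permutes {..m :: nat}" and "\<pi> \<noteq> id"
  obtains l where "l < m" "Max (\<pi> ` {..l}) = Max (\<pi> ` {..Suc l})"
proof (rule ccontr)
  assume "\<not> thesis"
  then have ne: "Max (\<pi> ` {..l}) \<noteq> Max (\<pi> ` {..Suc l})" if "l < m" for l
    using that \<open>\<And>l. \<lbrakk>l < m; Max (\<pi> ` {..l}) = Max (\<pi> ` {..Suc l})\<rbrakk> \<Longrightarrow> thesis\<close> by blast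
  have less: "Max (\<pi> ` {..l}) < Max (\<pi> ` {..Suc l})" if "l < m" for l
  proof -
    have "Max (\<pi> ` {..l}) \<le> Max (\<pi> ` {..Suc l})" by (intro Max_mono) auto
    then show ?thesis using ne[OF that] by (rule order_le_neq_trans)
  qed
  have le: "Max (\<pi> ` {..m - k}) \<le> m - k" if "k \<le> m" for k
    using that
  proof (induction k)
    case 0
    then show ?case using permutes_in_image[OF \<pi>] by auto
  next
    case (Suc k)
    have eq: "Suc (m - Suc k) = m - k" using Suc.prems by simp
    have "Max (\<pi> ` {..m - Suc k}) < Max (\<pi> ` {..m - k})"
      using less[of "m - Suc k"] Suc.prems unfolding eq by linarith
    also have "\<dots> \<le> m - k" using Suc.prems by (intro Suc.IH) linarith
    finally show ?case using eq by linarith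
  qed
  have "\<pi> l \<le> l" if "l \<in> {..m}" for l
  proof -
    have "\<pi> l \<le> Max (\<pi> ` {..l})" by (rule Max_ge) auto
    then show ?thesis using le[of "m - l"] that by simp
  qed
  then show False using permutes_natset_le[OF \<pi>] assms(2) by blast
qed

text \<open>For a point of block \<open>b\<close> this is \<open>b * q\<close>, the endpoint shared
  with the previous block. Subtracting 1 keeps the last point of a block in that block.\<close>

definition block_start :: "nat \<Rightarrow> nat \<Rightarrow> nat" where
  "block_start q x = (x - 1) div q * q"

text \<open>Each label is compared with the earlier ones of its block only, so that these labellings
  can be counted point by point. For whole blocks the condition means that every block, including
  its shared start, carries all \<open>p\<close> labels.\<close>

definition proper_labellings :: "nat \<Rightarrow> nat \<Rightarrow> (nat \<Rightarrow> nat) set" where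
  "proper_labellings p m =
    {a \<in> labellings p m. \<forall>x\<in>{1..m}. a x \<notin> a ` {block_start (p - 1) x..<x}}"

lemma block_start:
  assumes "1 \<le> i" "i \<le> q" shows "block_start q (b * q + i) = b * q"
proof -
  have "b * q + i - 1 = b * q + (i - 1)" using assms by simp
  then show ?thesis using assms unfolding block_start_def by (cases i) auto
qed

lemma proper_labellings_inj:
  assumes a: "a \<in> proper_labellings p m" and "1 \<le> i" "i \<le> p - 1" "b * (p - 1) + i \<le> m"
  shows "inj_on a {b * (p - 1)..b * (p - 1) + i}"
proof (rule linorder_inj_onI)
  fix x y assume xy: "x < y" "x \<in> {b * (p - 1)..b * (p - 1) + i}" "y \<in> {b * (p - 1)..b * (p - 1) + i}"
  define k where "k = y - b * (p - 1)"
  have k: "y = b * (p - 1) + k" "1 \<le> k" "k \<le> p - 1" using xy assms by (auto simp: k_def)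
  have "a y \<notin> a ` {block_start (p - 1) y..<y}"
    using a k xy assms(4) by (auto simp: proper_labellings_def)
  moreover have "block_start (p - 1) y = b * (p - 1)" using block_start k by simp
  moreover have "a x \<in> a ` {b * (p - 1)..<y}" using xy by (intro imageI) simp
  ultimately show "a x \<noteq> a y" by metis
qed auto

text \<open>The new point is number \<open>k\<close> of its block and has to avoid the
  \<open>k\<close> distinct labels already present there, which leaves \<open>p - k\<close>
  choices.\<close>

lemma card_proper_labellings_Suc:
  assumes p: "p \<ge> 2" and k: "1 \<le> k" "k \<le> p - 1" "Suc m = b * (p - 1) + k"
  shows "card (proper_labellings p (Suc m)) = card (proper_labellings p m) * (p - k)"
proof -
  let ?B = "\<lambda>a. {..<p} - a ` {b * (p - 1)..m}"
  let ?h = "\<lambda>(a, v). a(Suc m := v) :: nat \<Rightarrow> nat"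
  let ?S = "proper_labellings p m"
  have bs: "block_start (p - 1) (Suc m) = b * (p - 1)" using block_start k by simp
  have up: "(a(Suc m := v)) ` {block_start (p - 1) x..<x} = a ` {block_start (p - 1) x..<x}"
    if "x \<le> Suc m" for a v x
    using that by (intro image_cong) auto
  have S1: "{..Suc m} = insert (Suc m) {..m}" by auto
  have "proper_labellings p (Suc m) = ?h ` Sigma ?S ?B"
  proof (intro equalityI subsetI)
    fix a assume a: "a \<in> proper_labellings p (Suc m)"
    define g where "g = restrict a {..m}"
    have ag: "a = g(Suc m := a (Suc m))"
    proof
      fix x show "a x = (g(Suc m := a (Suc m))) x"
        using a by (cases "x \<le> m") (auto simp: g_def proper_labellings_def labellings_def PiE_def extensional_def)
    qed
    have imgs: "g ` {block_start (p - 1) x..<x} = a ` {block_start (p - 1) x..<x}" if "x \<le> Suc m" for x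
      using that by (intro image_cong) (auto simp: g_def)
    have "g \<in> labellings p m"
      using a by (auto simp: g_def proper_labellings_def labellings_def)
    then have "g \<in> ?S"
      using a imgs unfolding proper_labellings_def by (auto simp: g_def)
    moreover have "a (Suc m) \<in> ?B g"
    proof -
      have "a (Suc m) < p"
        using a p labellings_less[of a p "Suc m" "Suc m"] by (auto simp: proper_labellings_def)
      moreover have "a (Suc m) \<notin> a ` {b * (p - 1)..<Suc m}"
        using a bs unfolding proper_labellings_def by fastforce
      ultimately show ?thesis
        using imgs[of "Suc m"] bs by (auto simp: atLeastLessThanSuc_atLeastAtMost)
    qed
    ultimately have "(g, a (Suc m)) \<in> Sigma ?S ?B" by blast
    then show "a \<in> ?h ` Sigma ?S ?B"
      using ag by (intro image_eqI[of _ _ "(g, a (Suc m))"]) (simp only: case_prod_conv)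
  next
    fix a assume "a \<in> ?h ` Sigma ?S ?B"
    then obtain g v where g: "g \<in> ?S" "v \<in> ?B g" "a = g(Suc m := v)" by auto
    have "a \<in> labellings p (Suc m)"
      using g unfolding labellings_def S1 proper_labellings_def by (auto simp: PiE_def extensional_def)
    moreover have "a x \<notin> a ` {block_start (p - 1) x..<x}" if "x \<in> {1..Suc m}" for x
    proof (cases "x = Suc m")
      case True
      then show ?thesis using g up[of "Suc m"] bs by (auto simp: atLeastLessThanSuc_atLeastAtMost)
    next
      case False
      then have "x \<in> {1..m}" using that by auto
      then show ?thesis using g up[of x] False by (auto simp: proper_labellings_def)
    qed
    ultimately show "a \<in> proper_labellings p (Suc m)" by (simp add: proper_labellings_def)
  qed
  moreover have "inj_on ?h (Sigma ?S ?B)"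
  proof (rule inj_onI)
    fix u u' assume u: "u \<in> Sigma ?S ?B" "u' \<in> Sigma ?S ?B" "?h u = ?h u'"
    obtain g v g' v' where e: "u = (g, v)" "u' = (g', v')" by fastforce
    have eq: "(g(Suc m := v)) x = (g'(Suc m := v')) x" for x using u e by simp
    have "v = v'" using eq[of "Suc m"] by simp
    moreover have "g = g'"
    proof (rule PiE_ext)
      show "g \<in> PiE {..m} (labels p)" "g' \<in> PiE {..m} (labels p)"
        using u e by (auto simp: proper_labellings_def labellings_def)
      show "g x = g' x" if "x \<in> {..m}" for x using eq[of x] that by auto
    qed
    ultimately show "u = u'" using e by simp
  qed
  ultimately have "card (proper_labellings p (Suc m)) = card (Sigma ?S ?B)"
    by (simp add: card_image)
  also have "\<dots> = (\<Sum>g\<in>?S. card (?B g))"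
    by (rule card_SigmaI) (auto simp: proper_labellings_def finite_labellings)
  also have "\<dots> = (\<Sum>g\<in>?S. p - k)"
  proof (rule sum.cong[OF refl])
    fix g assume g: "g \<in> ?S"
    have "inj_on g {b * (p - 1)..m}"
    proof (cases "k = 1")
      case True
      then have "m = b * (p - 1)" using k by simp
      then show ?thesis by simp
    next
      case False
      have m: "m = b * (p - 1) + (k - 1)" using k by linarith
      show ?thesis
        by (subst m, rule proper_labellings_inj[OF g]) (use k False m in linarith)+
    qed
    then have "card (g ` {b * (p - 1)..m}) = k" using k by (simp add: card_image)
    moreover have "g ` {b * (p - 1)..m} \<subseteq> {..<p}"
      using g labellings_less[of g p m] p by (auto simp: proper_labellings_def)
    ultimately show "card (?B g) = p - k" by (simp add: card_Diff_subset finite_subset)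
  qed
  finally show ?thesis by simp
qed

text \<open>The count is a product of factors \<open>p - k\<close> with
  \<open>1 \<le> k \<le> p - 1\<close>, none divisible by the prime \<open>p\<close>.\<close>

lemma card_proper_labellings:
  assumes p: "prime p"
  shows "\<not> p dvd card (proper_labellings p m)"
proof (induction m)
  case 0
  have "proper_labellings p 0 = {\<lambda>x\<in>{..0}. 0}"
    by (auto simp: proper_labellings_def labellings_def PiE_def extensional_def)
  then show ?case using prime_ge_2_nat[OF p] by simp
next
  case (Suc m)
  have p2: "p \<ge> 2" using p by (rule prime_ge_2_nat)
  have "1 \<le> Suc m" "Suc m \<le> Suc m * (p - 1)" using mult_le_mono2[of 1 "p - 1" "Suc m"] p2 by simp_all
  then obtain b k where "1 \<le> k" "k \<le> p - 1" "Suc m = b * (p - 1) + k"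
    using block_decomposition[of "Suc m" "Suc m" "p - 1"] by metis
  moreover from this have "\<not> p dvd p - k"
    using p2 by (intro nat_dvd_not_less) auto
  ultimately show ?case
    using Suc p card_proper_labellings_Suc[OF p2, of k m b] by (simp add: prime_dvd_mult_iff)
qed

text \<open>If a block carries a permutation, only the missing label equal to that of the block
  start survives in the weight, and \<open>alt_square\<close> gives 1. Otherwise the factor of the
  cup product is 0.\<close>

lemma weight_mult_cup:
  assumes p: "p \<ge> 2" and a: "a \<in> labellings p (d * (p - 1))"
  shows "weight p d a * cup p d a = (if a \<in> proper_labellings p (d * (p - 1)) then 1 else 0)"
proof -
  let ?q = "p - 1"
  let ?w = "\<lambda>b i. a (b * ?q + i)"
  let ?F = "\<lambda>b. \<Sum>j<p. alt p (\<lambda>i. if i = 0 then j else ?w b i)"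
  have less: "?w b i < p" if "b < d" "i < p" for b i
    using labellings_less[OF a] block_le[of b d i ?q] that p by auto
  have factor: "?F b * alt p (?w b) = (if inj_on (?w b) {..<p} then 1 else 0)" if b: "b < d" for b
  proof (cases "inj_on (?w b) {..<p}")
    case True
    have surj: "?w b ` {..<p} = {..<p}"
      by (rule endo_inj_surj[OF _ _ True]) (use less[OF b] in auto)
    have "?F b = (\<Sum>j<p. if j = ?w b 0 then alt p (?w b) else 0)"
    proof (rule sum.cong[OF refl])
      fix j assume j: "j \<in> {..<p}"
      show "alt p (\<lambda>i. if i = 0 then j else ?w b i) = (if j = ?w b 0 then alt p (?w b) else 0)"
      proof (cases "j = ?w b 0")
        case True
        then show ?thesis by (auto intro!: alt_cong)
      next
        case False
        have "j \<in> ?w b ` {..<p}" using j surj by simp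
        then obtain i where i: "i < p" "j = ?w b i" by blast
        then have "i \<noteq> 0" using False by (cases i) auto
        then show ?thesis using False i p by (simp add: alt_eq_0[of 0 p i])
      qed
    qed
    also have "\<dots> = alt p (?w b)" using less[OF b, of 0] p by simp
    finally show ?thesis using alt_square[OF True] less[OF b] True by simp
  next
    case False
    then obtain i i' where "i < p" "i' < p" "i \<noteq> i'" "?w b i = ?w b i'" by (auto simp: inj_on_def)
    then show ?thesis using False alt_eq_0[of i p i' "?w b"] by simp
  qed
  have "weight p d a * cup p d a = (\<Prod>b<d. ?F b * alt p (?w b))"
    unfolding weight_def cup_def prod.distrib ..
  also have "\<dots> = (\<Prod>b<d. if inj_on (?w b) {..<p} then 1 else 0)"
    by (intro prod.cong refl factor) auto
  also have "\<dots> = (if \<forall>b<d. inj_on (?w b) {..<p} then 1 else 0)"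
    by auto
  also have "(\<forall>b<d. inj_on (?w b) {..<p}) \<longleftrightarrow> a \<in> proper_labellings p (d * ?q)"
  proof
    assume inj: "\<forall>b<d. inj_on (?w b) {..<p}"
    have "a x \<notin> a ` {block_start ?q x..<x}" if x: "x \<in> {1..d * ?q}" for x
    proof
      assume "a x \<in> a ` {block_start ?q x..<x}"
      then obtain y where y: "a x = a y" "block_start ?q x \<le> y" "y < x" by auto
      obtain b i where bi: "b < d" "1 \<le> i" "i \<le> ?q" "x = b * ?q + i"
        using x block_decomposition[of x d ?q] by auto
      define l where "l = y - b * ?q"
      have "b * ?q \<le> y" using y(2) bi block_start[of i ?q b] by simp
      then have l1: "y = b * ?q + l" by (simp add: l_def)
      have "l < i" using y(3) unfolding l1 bi(4) by simp
      note l = l1 this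
      then have "?w b i = ?w b l" using y bi by simp
      then have "i = l" using inj bi l by (auto simp: inj_on_def)
      then show False using l by simp
    qed
    then show "a \<in> proper_labellings p (d * ?q)" using a by (auto simp: proper_labellings_def)
  next
    assume pr: "a \<in> proper_labellings p (d * ?q)"
    show "\<forall>b<d. inj_on (?w b) {..<p}"
    proof (intro allI impI)
      fix b assume b: "b < d"
      have "inj_on a {b * ?q..b * ?q + ?q}"
        using proper_labellings_inj[OF pr, of ?q b] block_le[OF b order_refl, of ?q] p by simp
      then have "inj_on a ((\<lambda>i. b * ?q + i) ` {..<p})"
        by (rule inj_on_subset) auto
      then show "inj_on (?w b) {..<p}"
        using comp_inj_on[of "\<lambda>i. b * ?q + i" "{..<p}" a] by (simp add: o_def)
    qed
  qed
  finally show ?thesis .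
qed

text \<open>An order other than the identity repeats a running maximum, so its cup product vanishes
  by \<open>cup_eq_0\<close>. For the identity the sequence of top labels is \<open>a\<close>
  itself.\<close>

lemma chain_sum_top_label:
  assumes p: "prime p"
  shows "chain_sum p d (\<lambda>c. cup p d (\<lambda>l. top_label (c l))) = int (card (proper_labellings p (d * (p - 1))))"
proof -
  define N where "N = d * (p - 1)"
  let ?L = "labellings p N"
  have p2: "p \<ge> 2" using p by (rule prime_ge_2_nat)
  let ?g = "\<lambda>\<pi>. \<Sum>a\<in>?L. sign \<pi> * (weight p d a * cup p d (\<lambda>l. top_label (chain \<pi> a l)))"
  have top: "cup p d (\<lambda>l. top_label (chain \<pi> a l)) = cup p d (\<lambda>l. a (Max (\<pi> ` {..l})))"
    if "\<pi> permutes {..N}" "a \<in> ?L" for \<pi> a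
    using that p2 by (intro cup_cong top_label_chain) (auto simp: N_def)
  have zero: "?g \<pi> = 0" if \<pi>: "\<pi> permutes {..N}" "\<pi> \<noteq> id" for \<pi>
  proof -
    obtain l where l: "l < N" "Max (\<pi> ` {..l}) = Max (\<pi> ` {..Suc l})"
      using permutes_running_max[OF \<pi>] .
    have "cup p d (\<lambda>l. a (Max (\<pi> ` {..l}))) = 0" for a
      by (rule cup_eq_0[OF p2, of l]) (use l in \<open>auto simp: N_def\<close>)
    then show ?thesis using top[OF \<pi>(1)] by simp
  qed
  have "chain_sum p d (\<lambda>c. cup p d (\<lambda>l. top_label (c l))) = (\<Sum>\<pi> | \<pi> permutes {..N}. ?g \<pi>)"
    unfolding chain_sum_def N_def ..
  also have "\<dots> = (\<Sum>\<pi>\<in>{id}. ?g \<pi>)"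
    by (rule sum.mono_neutral_right) (use zero in \<open>auto simp: finite_permutations permutes_id\<close>)
  also have "\<dots> = (\<Sum>a\<in>?L. weight p d a * cup p d a)"
  proof -
    have "cup p d (\<lambda>l. top_label (chain id a l)) = cup p d a" if "a \<in> ?L" for a
    proof -
      have "Max (id ` {..l}) = l" for l :: nat by (rule Max_eqI) auto
      then show ?thesis using top[OF permutes_id that] by simp
    qed
    then show ?thesis by simp
  qed
  also have "\<dots> = (\<Sum>a\<in>?L. if a \<in> proper_labellings p N then 1 else 0)"
    by (intro sum.cong refl) (simp add: weight_mult_cup[OF p2] N_def)
  also have "\<dots> = int (card (?L \<inter> proper_labellings p N))"
    by (simp add: finite_labellings flip: sum.inter_restrict)
  also have "?L \<inter> proper_labellings p N = proper_labellings p N"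
    by (auto simp: proper_labellings_def)
  finally show ?thesis by (simp add: N_def)
qed

text \<open>The chain sum is nonzero, so some term is. Its nonzero weight gives distinct labels
  within each block, and its nonzero cup product gives the sign changes.\<close>

lemma tucker_blocks:
  assumes p: "prime p" and d: "d > 0" and s: "equivariant p {..d * (p - 1)} s"
  obtains \<pi> a where "\<pi> permutes {..d * (p - 1)}" "a \<in> labellings p (d * (p - 1))"
    "\<And>b. b < d \<Longrightarrow> inj_on (\<lambda>i. a (b * (p - 1) + i)) {1..p - 1}"
    "\<And>l. l < d * (p - 1) \<Longrightarrow> s (chain \<pi> a l) \<noteq> s (chain \<pi> a (Suc l))"
proof -
  have p2: "p \<ge> 2" using p by (rule prime_ge_2_nat)
  have "[chain_sum p d (\<lambda>c. cup p d (\<lambda>l. s (c l))) = int (card (proper_labellings p (d * (p - 1))))] (mod int p)"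
    unfolding chain_sum_top_label[OF p, symmetric]
    by (rule chain_sum_equivariant_cong[OF p d s equivariant_top_label]) (use p2 in auto)
  then have "chain_sum p d (\<lambda>c. cup p d (\<lambda>l. s (c l))) \<noteq> 0"
    using card_proper_labellings[OF p, of "d * (p - 1)"] by (metis cong_dvd_iff dvd_0_right int_dvd_int_iff)
  then obtain \<pi> a where 1: "\<pi> permutes {..d * (p - 1)}" "a \<in> labellings p (d * (p - 1))"
    "sign \<pi> * (weight p d a * cup p d (\<lambda>l. s (chain \<pi> a l))) \<noteq> 0"
    unfolding chain_sum_def by (smt (verit, ccfv_threshold) mem_Collect_eq sum.not_neutral_contains_not_neutral)
  then have "weight p d a \<noteq> 0" "cup p d (\<lambda>l. s (chain \<pi> a l)) \<noteq> 0" by auto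
  then show ?thesis
    using that[OF 1(1,2)] weight_nonzero_inj cup_eq_0[OF p2, of _ d "\<lambda>l. s (chain \<pi> a l)"] by blast
qed

section \<open>From blocks to arbitrary partitions\<close>

lemma partition_block_embedding:
  assumes V: "finite V" and P: "partition_on V P" and card: "\<forall>A\<in>P. card A \<le> q"
  obtains \<phi> e :: "_ \<Rightarrow> nat" and f where "inj_on \<phi> V" "\<phi> ` V \<subseteq> {1..card P * q}"
    "\<And>A. A \<in> P \<Longrightarrow> e A < card P"
    "\<And>A x. A \<in> P \<Longrightarrow> x \<in> A \<Longrightarrow> f A x \<in> {1..q} \<and> \<phi> x = e A * q + f A x"
proof -
  have finP: "finite P" using finite_elements[OF V P] .
  have union: "\<Union>P = V" and disj: "disjoint P" using P by (auto simp: partition_on_def)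
  have finA: "finite A" if "A \<in> P" for A using that union V by (auto intro: finite_subset)
  obtain e where "bij_betw e P {0..<card P}" using ex_bij_betw_finite_nat[OF finP] by blast
  then have e_inj: "inj_on e P" and e_less: "e A < card P" if "A \<in> P" for A
    using that by (auto simp: bij_betw_def)
  have "\<forall>A\<in>P. \<exists>g. g ` A \<subseteq> {1..q} \<and> inj_on g A"
    using card finA by (intro ballI card_le_inj) auto
  then obtain f where f: "\<And>A. A \<in> P \<Longrightarrow> f A ` A \<subseteq> {1..q} \<and> inj_on (f A) A" by metis
  define cls where "cls x = (THE A. A \<in> P \<and> x \<in> A)" for x
  have cls: "cls x = A" if "A \<in> P" "x \<in> A" for A x
    unfolding cls_def using that disj by (intro the_equality) (auto simp: disjoint_def)
  \<comment> \<open>Each class gets a block of its own. Positions within a block start at 1, so the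
    point 0 is always a dummy.\<close>
  define \<phi> where "\<phi> x = e (cls x) * q + f (cls x) x" for x
  have 1: "f A x \<in> {1..q} \<and> \<phi> x = e A * q + f A x" if "A \<in> P" "x \<in> A" for A x
    using f[OF that(1)] that cls[OF that] by (auto simp: \<phi>_def)
  have 2: "\<phi> ` V \<subseteq> {1..card P * q}"
  proof
    fix y assume "y \<in> \<phi> ` V"
    then obtain x A where "x \<in> A" "A \<in> P" "y = \<phi> x" using union by auto
    then show "y \<in> {1..card P * q}"
      using 1[of A x] block_le[OF e_less[of A], of "f A x" q] by auto
  qed
  have 3: "inj_on \<phi> V"
  proof (rule inj_onI)
    fix x y assume "x \<in> V" "y \<in> V" and eq: "\<phi> x = \<phi> y"
    then obtain A B where A: "A \<in> P" "x \<in> A" and B: "B \<in> P" "y \<in> B" using union by auto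
    have "e A * q + f A x = e B * q + f B y" using 1[OF A] 1[OF B] eq by simp
    then have "e A = e B" "f A x = f B y"
      using block_unique[of "f A x" q "f B y" "e A" "e B"] 1[OF A] 1[OF B] by auto
    moreover from this have "A = B" using e_inj[OF A(1)] A B by (auto dest: inj_onD)
    ultimately show "x = y" using f[OF A(1)] A B by (auto dest: inj_onD)
  qed
  show thesis by (rule that[of \<phi> e f]) (use 1 2 3 e_less in blast)+
qed

definition pullback :: "'a set \<Rightarrow> ('a \<Rightarrow> nat) \<Rightarrow> (nat \<times> nat) set \<Rightarrow> ('a \<times> nat) set" where
  "pullback V \<phi> X = {(x, v). x \<in> V \<and> (\<phi> x, v) \<in> X}"

lemma pullback_rot: "pullback V \<phi> (rot p X) = rot p (pullback V \<phi> X)"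
  unfolding pullback_def rot_def by force

lemma config_pullback:
  assumes "config p W X" "pullback V \<phi> X \<noteq> {}"
  shows "config p V (pullback V \<phi> X)"
  unfolding config_def
proof (intro conjI)
  show "pullback V \<phi> X \<subseteq> V \<times> {..<p}"
    using assms by (auto simp: pullback_def config_def)
  show "inj_on fst (pullback V \<phi> X)"
    using config_unique[OF assms(1)] by (auto simp: pullback_def inj_on_def)
qed fact

text \<open>A configuration made of dummies only has an empty pullback, on which \<open>s\<close> is
  unconstrained; the top label supplies an equivariant value there.\<close>

lemma equivariant_pullback:
  assumes p: "p > 0" and W: "finite W" and s: "equivariant p V s"
  shows "equivariant p W (\<lambda>X. if pullback V \<phi> X = {} then top_label X else s (pullback V \<phi> X))"
  unfolding equivariant_def
proof (intro allI impI)
  fix X assume X: "config p W X"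
  have "top_label X < p \<and> top_label (rot p X) = rho p (top_label X)"
    using equivariant_top_label[OF p W] X unfolding equivariant_def by blast
  moreover have "s (pullback V \<phi> X) < p \<and> s (rot p (pullback V \<phi> X)) = rho p (s (pullback V \<phi> X))"
    if "pullback V \<phi> X \<noteq> {}"
    using s config_pullback[OF X that] unfolding equivariant_def by blast
  moreover have "pullback V \<phi> (rot p X) = {} \<longleftrightarrow> pullback V \<phi> X = {}"
    unfolding pullback_rot by (simp add: rot_def)
  ultimately show "(if pullback V \<phi> X = {} then top_label X else s (pullback V \<phi> X)) < p \<and>
      (if pullback V \<phi> (rot p X) = {} then top_label (rot p X) else s (pullback V \<phi> (rot p X))) =
      rho p (if pullback V \<phi> X = {} then top_label X else s (pullback V \<phi> X))"
    by (auto simp: pullback_rot)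
qed

text \<open>A point outside \<open>\<phi> ` V\<close> that is inserted after a point of \<open>\<phi> ` V\<close> does not change the
  sign. Hence in a chain with sign changes throughout, the points outside come first.\<close>

theorem tucker_partition:
  fixes V :: "'a set"
  assumes p: "prime p" and V: "finite V" "V \<noteq> {}" and P: "partition_on V P"
    and card: "\<forall>A\<in>P. card A \<le> p - 1" and s: "equivariant p V s"
  obtains X :: "nat \<Rightarrow> ('a \<times> nat) set" where
    "\<And>l. 1 \<le> l \<Longrightarrow> l \<le> card V \<Longrightarrow> config p V (X l)"
    "\<And>l. l \<le> card V \<Longrightarrow> card (X l) = l"
    "\<And>l. X l \<subseteq> X (Suc l)"
    "\<And>l. 1 \<le> l \<Longrightarrow> l < card V \<Longrightarrow> s (X l) \<noteq> s (X (Suc l))"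
    "\<And>l A x y j. l \<le> card V \<Longrightarrow> A \<in> P \<Longrightarrow> x \<in> A \<Longrightarrow> y \<in> A \<Longrightarrow> (x, j) \<in> X l \<Longrightarrow> (y, j) \<in> X l \<Longrightarrow> x = y"
proof -
  let ?q = "p - 1"
  define d where "d = card P"
  define N where "N = d * ?q"
  have p0: "p > 0" using p by (simp add: prime_gt_0_nat)
  have union: "\<Union>P = V" using P by (simp add: partition_on_def)
  have d: "d > 0" using finite_elements[OF V(1) P] V(2) union by (auto simp: d_def card_gt_0_iff)
  obtain \<phi> e f where \<phi>: "inj_on \<phi> V" "\<phi> ` V \<subseteq> {1..N}"
    and e: "\<And>A. A \<in> P \<Longrightarrow> e A < d"
    and f: "\<And>A x. A \<in> P \<Longrightarrow> x \<in> A \<Longrightarrow> f A x \<in> {1..?q} \<and> \<phi> x = e A * ?q + f A x"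
    using partition_block_embedding[OF V(1) P card] unfolding d_def N_def by metis
  define s' where "s' X = (if pullback V \<phi> X = {} then top_label X else s (pullback V \<phi> X))" for X
  have "equivariant p {..d * ?q} s'"
    unfolding s'_def by (intro equivariant_pullback p0 s) simp
  then obtain \<pi> a where \<pi>: "\<pi> permutes {..N}" and a: "a \<in> labellings p N"
    and inj: "\<And>b. b < d \<Longrightarrow> inj_on (\<lambda>i. a (b * ?q + i)) {1..?q}"
    and alt: "\<And>l. l < N \<Longrightarrow> s' (chain \<pi> a l) \<noteq> s' (chain \<pi> a (Suc l))"
    using tucker_blocks[OF p d] unfolding N_def by metis
  have \<pi>_inj: "\<pi> x = \<pi> y \<longleftrightarrow> x = y" for x y using inj_eq[OF permutes_inj[OF \<pi>]] .
  define I where "I = \<phi> ` V"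
  have pb: "pullback V \<phi> (chain \<pi> a l) = {(x, a (\<phi> x)) | x. x \<in> V \<and> \<phi> x \<in> \<pi> ` {..l}}" for l
    by (auto simp: pullback_def chain_def)
  have I_sub: "I \<subseteq> \<pi> ` {..N}" using \<phi>(2) permutes_image[OF \<pi>] by (auto simp: I_def)
  obtain x0 where "x0 \<in> V" using V(2) by blast
  then have "\<phi> x0 \<in> I" by (simp add: I_def)
  then have "\<exists>l. \<pi> l \<in> I" using I_sub by (metis imageE subsetD)
  define l0 where "l0 = (LEAST l. \<pi> l \<in> I)"
  have l0: "\<pi> l0 \<in> I" unfolding l0_def by (rule LeastI_ex) fact
  have before: "\<pi> l \<notin> I" if "l < l0" for l using not_less_Least that unfolding l0_def by blast
  have after: "\<pi> (l0 + i) \<in> I" if "l0 + i \<le> N" for i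
    using that
  proof (induction i)
    case (Suc i)
    show ?case
    proof (rule ccontr)
      assume "\<pi> (l0 + Suc i) \<notin> I"
      then have "\<phi> x \<noteq> \<pi> (Suc (l0 + i))" if "x \<in> V" for x
        using that unfolding I_def by (metis add_Suc_right imageI)
      then have "pullback V \<phi> (chain \<pi> a (Suc (l0 + i))) = pullback V \<phi> (chain \<pi> a (l0 + i))"
        unfolding pb by (auto simp: atMost_Suc)
      moreover have "pullback V \<phi> (chain \<pi> a (l0 + i)) \<noteq> {}"
      proof -
        obtain x where "x \<in> V" "\<phi> x = \<pi> l0" using l0 by (auto simp: I_def)
        then show ?thesis unfolding pb by auto
      qed
      ultimately have "s' (chain \<pi> a (Suc (l0 + i))) = s' (chain \<pi> a (l0 + i))"
        by (simp add: s'_def)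
      then show False using alt[of "l0 + i"] Suc.prems by simp
    qed
  qed (simp add: l0)
  have I_eq: "I = \<pi> ` {l0..N}"
  proof
    show "I \<subseteq> \<pi> ` {l0..N}"
    proof
      fix y assume "y \<in> I"
      then obtain l where "l \<le> N" "y = \<pi> l" using I_sub by auto
      then show "y \<in> \<pi> ` {l0..N}" using before[of l] \<open>y \<in> I\<close> by (cases "l < l0") auto
    qed
    show "\<pi> ` {l0..N} \<subseteq> I"
    proof
      fix y assume "y \<in> \<pi> ` {l0..N}"
      then obtain l where "l0 \<le> l" "l \<le> N" "y = \<pi> l" by auto
      then show "y \<in> I" using after[of "l - l0"] by simp
    qed
  qed
  have n: "card V = Suc N - l0"
  proof -
    have "card V = card I" unfolding I_def using \<phi>(1) by (simp add: card_image)
    also have "\<dots> = card {l0..N}" unfolding I_eq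
      by (rule card_image) (simp add: inj_on_def \<pi>_inj)
    finally show ?thesis by simp
  qed
  \<comment> \<open>The genuine points in their order of entry, meaningful for
    \<open>i < card V\<close>.\<close>
  define u where "u i = inv_into V \<phi> (\<pi> (l0 + i))" for i
  have u: "u i \<in> V" "\<phi> (u i) = \<pi> (l0 + i)" if "i < card V" for i
  proof -
    have "\<pi> (l0 + i) \<in> \<phi> ` V" using after[of i] that n unfolding I_def by simp
    then show "u i \<in> V" "\<phi> (u i) = \<pi> (l0 + i)"
      unfolding u_def by (rule inv_into_into, rule f_inv_into_f)
  qed
  have u_inj: "inj_on u {..<card V}"
  proof (rule inj_onI)
    fix i j assume "i \<in> {..<card V}" "j \<in> {..<card V}" "u i = u j"
    then have "\<pi> (l0 + i) = \<pi> (l0 + j)" using u(2)[of i] u(2)[of j] by auto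
    then show "i = j" by (simp add: \<pi>_inj)
  qed
  define X where "X l = (\<lambda>i. (u i, a (\<phi> (u i)))) ` {..<l}" for l
  \<comment> \<open>The index shifts by one because \<open>chain \<pi> a l\<close> contains
    \<open>\<pi> 0\<close> and hence \<open>l + 1\<close> points.\<close>
  have X_eq: "pullback V \<phi> (chain \<pi> a (l0 + l)) = X (Suc l)" if "l < card V" for l
  proof (intro equalityI subsetI)
    fix z assume "z \<in> pullback V \<phi> (chain \<pi> a (l0 + l))"
    then obtain x i where x: "x \<in> V" "z = (x, a (\<phi> x))" "\<phi> x = \<pi> i" "i \<le> l0 + l"
      unfolding pb by auto
    have "l0 \<le> i" using before[of i] x unfolding I_def by (metis imageI not_less)
    define m where "m = i - l0"
    have m: "i = l0 + m" "m \<le> l" using \<open>l0 \<le> i\<close> x by (auto simp: m_def)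
    have "\<phi> x = \<phi> (u m)" using u(2)[of m] m x that by simp
    then have "x = u m" using inj_onD[OF \<phi>(1)] x u(1)[of m] m that by simp
    then show "z \<in> X (Suc l)" unfolding X_def using m x by auto
  next
    fix z assume "z \<in> X (Suc l)"
    then obtain i where i: "i < Suc l" "z = (u i, a (\<phi> (u i)))" unfolding X_def by blast
    have "\<pi> (l0 + i) \<in> \<pi> ` {..l0 + l}" using i by (intro imageI) simp
    then show "z \<in> pullback V \<phi> (chain \<pi> a (l0 + l))"
      unfolding pb using u[of i] i that by auto
  qed
  have a_less: "a (\<phi> x) < p" if "x \<in> V" for x
    using labellings_less[OF a p0, of "\<phi> x"] \<phi>(2) that by auto
  show thesis
  proof (rule that[of X])
    show "config p V (X l)" if "1 \<le> l" "l \<le> card V" for l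
      unfolding config_def
    proof (intro conjI)
      show "X l \<noteq> {}" using that by (auto simp: X_def lessThan_empty_iff)
      show "X l \<subseteq> V \<times> {..<p}" using u(1) a_less that by (auto simp: X_def)
      show "inj_on fst (X l)" by (auto simp: X_def inj_on_def)
    qed
    show "card (X l) = l" if "l \<le> card V" for l
    proof -
      have "inj_on (\<lambda>i. (u i, a (\<phi> (u i)))) {..<l}"
        using inj_on_subset[OF u_inj, of "{..<l}"] that by (auto simp: inj_on_def)
      then show ?thesis unfolding X_def by (simp add: card_image)
    qed
    show "X l \<subseteq> X (Suc l)" for l by (auto simp: X_def)
    show "s (X l) \<noteq> s (X (Suc l))" if l: "1 \<le> l" "l < card V" for l
    proof -
      obtain m where m: "l = Suc m" using l by (cases l) auto
      have "X (Suc m) \<noteq> {}" "X (Suc (Suc m)) \<noteq> {}" by (auto simp: X_def)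
      then have "s' (chain \<pi> a (l0 + m)) = s (X (Suc m))" "s' (chain \<pi> a (l0 + Suc m)) = s (X (Suc (Suc m)))"
        unfolding s'_def using X_eq[of m] X_eq[of "Suc m"] l m by auto
      then show ?thesis using alt[of "l0 + m"] l m n by auto
    qed
    show "x = y" if "l \<le> card V" "A \<in> P" "x \<in> A" "y \<in> A" "(x, j) \<in> X l" "(y, j) \<in> X l" for l A x y j
    proof -
      have "a (\<phi> x) = a (\<phi> y)" using that(5,6) by (auto simp: X_def)
      then have "a (e A * ?q + f A x) = a (e A * ?q + f A y)" using f[OF that(2,3)] f[OF that(2,4)] by simp
      then have "f A x = f A y"
        using inj_onD[OF inj[OF e[OF that(2)]]] f[OF that(2,3)] f[OF that(2,4)] by blast
      then have "\<phi> x = \<phi> y" using f[OF that(2,3)] f[OF that(2,4)] by simp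
      then show ?thesis using inj_onD[OF \<phi>(1)] that union by blast
    qed
  qed
qed

section \<open>The lower bound\<close>

text \<open>The mean of the residues in \<open>J\<close>, computed modulo \<open>p\<close>.\<close>

definition choice :: "nat \<Rightarrow> nat set \<Rightarrow> nat" where
  "choice p J = (SOME u. [card J * u = 1] (mod p)) * \<Sum>J mod p"

text \<open>The size of a proper nonempty \<open>J\<close> is invertible modulo \<open>p\<close>.
  Rotation adds \<open>card J\<close> to the sum modulo \<open>p\<close>, hence 1 to the mean. The
  chosen inverse depends on \<open>card J\<close> only, so it is the same for both sets.\<close>

lemma choice_rho:
  assumes p: "prime p" and J: "J \<subseteq> {..<p}" "J \<noteq> {}" "J \<noteq> {..<p}"
  shows "choice p J < p" "choice p (rho p ` J) = rho p (choice p J)"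
proof -
  have p0: "p > 0" using p by (simp add: prime_gt_0_nat)
  then show "choice p J < p" by (simp add: choice_def)
  have fin: "finite J" using J finite_subset by blast
  have inj: "inj_on (rho p) J" using J rho_eq_iff by (intro inj_onI) blast
  have "card J < p" using psubset_card_mono[of "{..<p}" J] J by auto
  moreover have "card J > 0" using J fin by (simp add: card_gt_0_iff)
  ultimately have "coprime (card J) p"
    using p by (metis coprime_commute prime_imp_coprime nat_dvd_not_less)
  then obtain u where "[card J * u = 1] (mod p)"
    using cong_solve_coprime_nat[of "card J" p] by auto
  define w where "w = (SOME u. [card J * u = 1] (mod p))"
  have w: "[card J * w = 1] (mod p)" unfolding w_def by (rule someI) fact
  have "[\<Sum>(rho p ` J) = (\<Sum>j\<in>J. j + 1)] (mod p)"
    unfolding sum.reindex[OF inj] by (intro cong_sum) (simp add: rho_def cong_def)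
  then have "[w * \<Sum>(rho p ` J) = w * (\<Sum>J + card J)] (mod p)"
    by (intro cong_scalar_left) (simp only: sum.distrib card_eq_sum)
  also have "w * (\<Sum>J + card J) = w * \<Sum>J + card J * w" by (simp add: algebra_simps)
  also have "[\<dots> = w * \<Sum>J + 1] (mod p)" using w by (intro cong_add) auto
  finally have "w * \<Sum>(rho p ` J) mod p = Suc (w * \<Sum>J) mod p" by (simp add: cong_def)
  then show "choice p (rho p ` J) = rho p (choice p J)"
    unfolding choice_def card_image[OF inj] w_def[symmetric] rho_def by (simp add: mod_Suc_eq)
qed

section \<open>Slices under rotation\<close>

definition slice :: "('a \<times> nat) set \<Rightarrow> nat \<Rightarrow> 'a set" where
  "slice X j = {x. (x, j) \<in> X}"

lemma slice_mono: "X \<subseteq> Y \<Longrightarrow> slice X j \<subseteq> slice Y j"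
  by (auto simp: slice_def)

lemma slice_rot:
  assumes "config p V X" "j < p" shows "slice (rot p X) (rho p j) = slice X j"
proof (intro equalityI subsetI)
  fix x assume "x \<in> slice (rot p X) (rho p j)"
  then obtain i where i: "(x, i) \<in> X" "rho p i = rho p j" by (auto simp: slice_def rot_def)
  then have "i < p" using assms(1) by (auto simp: config_def)
  then show "x \<in> slice X j" using i rho_eq_iff[of i p j] assms(2) by (simp add: slice_def)
next
  fix x assume "x \<in> slice X j"
  then show "x \<in> slice (rot p X) (rho p j)" unfolding slice_def rot_def by (force simp: map_prod_def)
qed

lemma Collect_slice_rot:
  assumes X: "config p V X" and p: "p > 0"
  shows "{j. j < p \<and> Q (slice (rot p X) j)} = rho p ` {j. j < p \<and> Q (slice X j)}"
proof (intro equalityI subsetI)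
  fix i assume "i \<in> {j. j < p \<and> Q (slice (rot p X) j)}"
  then have i: "i < p" "Q (slice (rot p X) i)" by auto
  then have "i \<in> rho p ` {..<p}" using bij_betw_imp_surj_on[OF bij_betw_rho[OF p]] by simp
  then obtain j where "j < p" "i = rho p j" by auto
  then show "i \<in> rho p ` {j. j < p \<and> Q (slice X j)}" using i slice_rot[OF X] by auto
qed (use slice_rot[OF X] rho_less[OF p] in auto)

lemma strict_increase_le:
  fixes f :: "nat \<Rightarrow> nat"
  assumes "a \<le> b" "\<And>l. a \<le> l \<Longrightarrow> l < b \<Longrightarrow> f l < f (Suc l)"
  shows "f a + (b - a) \<le> f b"
  using assms
proof (induction b rule: dec_induct)
  case (step n)
  have "f a + (n - a) \<le> f n" using step by simp
  moreover have "f n < f (Suc n)" using step by simp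
  ultimately show ?case using step.hyps by linarith
qed simp

section \<open>The sign map of a coloring\<close>

locale wide_coloring =
  fixes p n k t C :: nat and P :: "nat set set" and c :: "nat set \<Rightarrow> nat"
  assumes p: "prime p" and k: "k \<ge> 2" and P: "partition_on {1..n} P"
    and cardP: "\<forall>A\<in>P. card A \<le> p - 1"
    and coloring: "is_coloring (KG_wide p n k P t) C c"
begin

abbreviation "verts \<equiv> KG_wide_verts n k P t"

definition colors :: "nat set \<Rightarrow> nat set" where
  "colors S = c ` {\<sigma> \<in> verts. \<sigma> \<subseteq> S}"

definition all_colors :: "(nat \<times> nat) set \<Rightarrow> nat set" where
  "all_colors X = (\<Union>j<p. colors (slice X j))"

definition top_colored :: "(nat \<times> nat) set \<Rightarrow> nat set" where
  "top_colored X = {j. j < p \<and> Max (all_colors X) \<in> colors (slice X j)}"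

definition left :: "(nat \<times> nat) set \<Rightarrow> nat set" where
  "left X = {j. j < p \<and> (\<exists>x\<in>slice X j. x + t \<le> Max (fst ` X))}"

definition wide :: "(nat \<times> nat) set \<Rightarrow> nat set" where
  "wide X = {j. j < p \<and> (\<exists>x\<in>slice X j. \<exists>y\<in>slice X j. x + t \<le> y)}"

text \<open>If there is no color and all slices are wide, then each slice has at most \<open>k - 1\<close> points, and
  the choice of the sign does not matter.\<close>

definition chain_sign :: "(nat \<times> nat) set \<Rightarrow> nat" where
  "chain_sign X = (if all_colors X \<noteq> {} then choice p (top_colored X)
     else if card X \<le> t \<or> wide X = {..<p} then top_label X
     else if left X \<noteq> {..<p} then choice p (left X)
     else choice p (wide X))"

lemma p0: "p > 0" and p2: "p \<ge> 2"
  using p by (simp_all add: prime_gt_0_nat prime_ge_2_nat)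

lemma colors_subset: "colors S \<subseteq> {1..C}"
  using coloring unfolding is_coloring_def KG_wide_def colors_def by auto

lemma all_colors_subset: "all_colors X \<subseteq> {1..C}"
  using colors_subset unfolding all_colors_def by blast

lemma finite_all_colors: "finite (all_colors X)"
  by (rule finite_subset[OF all_colors_subset]) simp

lemma colors_mono: "S \<subseteq> T \<Longrightarrow> colors S \<subseteq> colors T"
  unfolding colors_def by auto

lemma all_colors_mono: "X \<subseteq> Y \<Longrightarrow> all_colors X \<subseteq> all_colors Y"
  unfolding all_colors_def by (intro UN_mono colors_mono slice_mono) auto

text \<open>If every slice attained the largest color, one admissible set of this color from each
  slice would form a monochromatic hyperedge. These sets are distinct because they are disjoint and
  nonempty.\<close>

lemma top_colored_proper:
  assumes X: "config p {1..n} X" and ne: "all_colors X \<noteq> {}"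
  shows "top_colored X \<noteq> {}" "top_colored X \<noteq> {..<p}"
proof -
  let ?m = "Max (all_colors X)"
  have "?m \<in> all_colors X" using finite_all_colors ne by (rule Max_in)
  then show "top_colored X \<noteq> {}" by (auto simp: top_colored_def all_colors_def)
  show "top_colored X \<noteq> {..<p}"
  proof
    assume eq: "top_colored X = {..<p}"
    have "\<exists>\<sigma>. \<sigma> \<in> verts \<and> \<sigma> \<subseteq> slice X j \<and> c \<sigma> = ?m" if "j < p" for j
    proof -
      have "j \<in> top_colored X" using eq that by simp
      then show ?thesis by (auto simp: top_colored_def colors_def)
    qed
    then obtain \<sigma> where \<sigma>: "\<And>j. j < p \<Longrightarrow> \<sigma> j \<in> verts \<and> \<sigma> j \<subseteq> slice X j \<and> c (\<sigma> j) = ?m"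
      by metis
    have disj: "\<sigma> i \<inter> \<sigma> j = {}" if "i < p" "j < p" "i \<noteq> j" for i j
    proof -
      have "slice X i \<inter> slice X j = {}"
        using config_unique[OF X] that(3) by (auto simp: slice_def)
      then show ?thesis using \<sigma>[OF that(1)] \<sigma>[OF that(2)] by blast
    qed
    have ne: "\<sigma> j \<noteq> {}" if "j < p" for j
    proof
      assume "\<sigma> j = {}"
      then have "card (\<sigma> j) = 0" by simp
      then show False using \<sigma>[OF that] k by (simp add: KG_wide_verts_def)
    qed
    have "inj_on \<sigma> {..<p}"
    proof (rule inj_onI, rule ccontr)
      fix i j assume "i \<in> {..<p}" "j \<in> {..<p}" "\<sigma> i = \<sigma> j" "i \<noteq> j"
      then show False using disj[of i j] ne[of i] by auto
    qed
    then have "card (\<sigma> ` {..<p}) = p" by (simp add: card_image)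
    moreover have "pairwise disjnt (\<sigma> ` {..<p})"
    proof (rule pairwiseI)
      fix A B assume "A \<in> \<sigma> ` {..<p}" "B \<in> \<sigma> ` {..<p}" "A \<noteq> B"
      then obtain i j where "i < p" "j < p" "A = \<sigma> i" "B = \<sigma> j" "i \<noteq> j" by auto
      then show "disjnt A B" using disj by (simp add: disjnt_def)
    qed
    ultimately have "\<sigma> ` {..<p} \<in> hedges (KG_wide p n k P t)"
      using \<sigma> by (auto simp: KG_wide_def)
    then have "\<not> monochromatic c (\<sigma> ` {..<p})" using coloring by (auto simp: is_coloring_def)
    then show False using \<sigma> by (auto simp: monochromatic_def)
  qed
qed

text \<open>More than \<open>t\<close> distinct integers span a distance of at least
  \<open>t\<close>, so the slice of the smallest point qualifies.\<close>

lemma left_nonempty: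
  assumes X: "config p {1..n} X" and "card X > t"
  shows "left X \<noteq> {}"
proof -
  let ?D = "fst ` X"
  have fin: "finite X" using config_finite[OF X] by simp
  have ne: "?D \<noteq> {}" using X by (auto simp: config_def)
  have "card ?D = card X" using X by (simp add: config_def card_image)
  moreover have "?D \<subseteq> {Min ?D..Max ?D}" using fin by (intro subsetI) (simp add: Min_le Max_ge)
  then have "card ?D \<le> card {Min ?D..Max ?D}" by (rule card_mono[rotated]) simp
  ultimately have "Min ?D + t \<le> Max ?D" using assms(2) by simp
  moreover have "Min ?D \<in> ?D" using fin ne by (intro Min_in) auto
  then obtain j where "(Min ?D, j) \<in> X" by force
  moreover from this have "j < p" using X by (auto simp: config_def)
  ultimately have "j \<in> left X" by (auto simp: left_def slice_def)
  then show ?thesis by auto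
qed

text \<open>The slice that contains the largest point also has a point at least \<open>t\<close>
  before it.\<close>

lemma wide_nonempty:
  assumes X: "config p {1..n} X" and "left X = {..<p}"
  shows "wide X \<noteq> {}"
proof -
  let ?D = "fst ` X"
  have fin: "finite X" using config_finite[OF X] by simp
  have ne: "?D \<noteq> {}" using X by (auto simp: config_def)
  have "Max ?D \<in> ?D" using fin ne by (intro Max_in) auto
  then obtain j where j: "(Max ?D, j) \<in> X" by force
  then have "j < p" using X by (auto simp: config_def)
  then have "j \<in> left X" using assms(2) by simp
  then have "j \<in> wide X" using j by (auto simp: left_def wide_def slice_def)
  then show ?thesis by auto
qed

text \<open>The case distinction is invariant under rotation, and each case hands
  \<open>choice\<close> a proper nonempty set: \<open>card X > t\<close> makes \<open>left X\<close>
  nonempty, and a full \<open>left X\<close> makes \<open>wide X\<close> nonempty.\<close>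

lemma equivariant_chain_sign: "equivariant p {1..n} chain_sign"
  unfolding equivariant_def
proof (intro allI impI)
  fix X assume X: "config p {1..n} X"
  have colors: "all_colors (rot p X) = all_colors X"
  proof -
    have "all_colors (rot p X) = (\<Union>j\<in>rho p ` {..<p}. colors (slice (rot p X) j))"
      unfolding all_colors_def bij_betw_imp_surj_on[OF bij_betw_rho[OF p0]] ..
    also have "\<dots> = all_colors X" using slice_rot[OF X] by (auto simp: all_colors_def)
    finally show ?thesis .
  qed
  have top: "top_colored (rot p X) = rho p ` top_colored X"
    unfolding top_colored_def colors by (rule Collect_slice_rot[OF X p0])
  have left: "left (rot p X) = rho p ` left X"
    unfolding left_def fst_rot by (rule Collect_slice_rot[OF X p0])
  have wide: "wide (rot p X) = rho p ` wide X"
    unfolding wide_def by (rule Collect_slice_rot[OF X p0])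
  have full: "rho p ` J = {..<p} \<longleftrightarrow> J = {..<p}" if "J \<subseteq> {..<p}" for J
    using inj_on_image_eq_iff[OF bij_betw_imp_inj_on[OF bij_betw_rho[OF p0]] that, of "{..<p}"]
      bij_betw_imp_surj_on[OF bij_betw_rho[OF p0]] by simp
  have sub: "top_colored X \<subseteq> {..<p}" "left X \<subseteq> {..<p}" "wide X \<subseteq> {..<p}"
    by (auto simp: top_colored_def left_def wide_def)
  have card: "card (rot p X) = card X"
  proof -
    have "card (fst ` rot p X) = card (rot p X)"
      using rot_config[OF X p0] by (simp add: config_def card_image)
    moreover have "card (fst ` X) = card X" using X by (simp add: config_def card_image)
    ultimately show ?thesis by (simp add: fst_rot)
  qed
  have label: "top_label X < p \<and> top_label (rot p X) = rho p (top_label X)"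
    using equivariant_top_label[OF p0, of "{1..n}"] X by (simp add: equivariant_def)
  show "chain_sign X < p \<and> chain_sign (rot p X) = rho p (chain_sign X)"
    unfolding chain_sign_def colors top left wide card full[OF sub(2)] full[OF sub(3)]
    using label top_colored_proper[OF X] choice_rho[OF p sub(1)]
      left_nonempty[OF X] choice_rho[OF p sub(2)] wide_nonempty[OF X] choice_rho[OF p sub(3)]
    by (simp add: not_le)
qed

text \<open>From a wide slice with at least \<open>k\<close> points one can pick \<open>k\<close> of
  them including two at distance at least \<open>t\<close>. They form an admissible set, which would
  have a color.\<close>

lemma wide_small:
  assumes X: "config p {1..n} X" and bad: "all_colors X = {}" and j: "j \<in> wide X"
    and P_inj: "\<And>A x y. A \<in> P \<Longrightarrow> x \<in> A \<Longrightarrow> y \<in> A \<Longrightarrow> (x, j) \<in> X \<Longrightarrow> (y, j) \<in> X \<Longrightarrow> x = y"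
  shows "card (slice X j) \<le> k - 1"
proof (rule ccontr)
  assume "\<not> card (slice X j) \<le> k - 1"
  then have big: "k \<le> card (slice X j)" by simp
  obtain x y where xy: "j < p" "x \<in> slice X j" "y \<in> slice X j" "x + t \<le> y"
    using j by (auto simp: wide_def)
  have sub: "slice X j \<subseteq> {1..n}" using X by (auto simp: config_def slice_def)
  have fin: "finite (slice X j)" using sub finite_subset by blast
  have "card {x, y} \<le> k" using k card_insert_le_m1[of 2 "{y}" x] by (simp add: card_insert_if)
  then obtain \<sigma> where \<sigma>: "{x, y} \<subseteq> \<sigma>" "\<sigma> \<subseteq> slice X j" "card \<sigma> = k"
    using exists_subset_between[of "{x, y}" k "slice X j"] big xy fin by auto
  have "\<sigma> \<in> verts"
    unfolding KG_wide_verts_def t_wide_def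
  proof (intro CollectI conjI allI impI ballI)
    show "\<sigma> \<subseteq> {1..n}" "card \<sigma> = k" using \<sigma> sub by auto
    fix i assume "1 \<le> i \<and> i + t \<le> n + 1"
    show "\<not> \<sigma> \<subseteq> {i..<i + t}"
    proof
      assume "\<sigma> \<subseteq> {i..<i + t}"
      then have "x \<in> {i..<i + t}" "y \<in> {i..<i + t}" using \<sigma> by auto
      then show False using xy by simp
    qed
  next
    fix A assume "A \<in> P"
    then have "x = y" if "x \<in> \<sigma> \<inter> A" "y \<in> \<sigma> \<inter> A" for x y
      using P_inj[of A x y] that \<sigma>(2) by (auto simp: slice_def)
    then show "card (\<sigma> \<inter> A) \<le> 1"
      using finite_subset[OF \<sigma>(2) fin] by (simp add: card_le_Suc0_iff_eq)
  qed
  then have "c \<sigma> \<in> all_colors X"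
    using \<sigma>(2) xy(1) by (auto simp: all_colors_def colors_def)
  then show False using bad by simp
qed

theorem wide_coloring_bound:
  assumes t: "t \<le> p * (k - 3) + 2" and k3: "k \<ge> 3" and n: "n \<ge> 1"
  shows "n \<le> p * (k - 1) + (p - 1) * C"
proof -
  have "{1..n} \<noteq> {}" using n by auto
  then obtain X :: "nat \<Rightarrow> (nat \<times> nat) set" where
    X: "\<And>l. 1 \<le> l \<Longrightarrow> l \<le> n \<Longrightarrow> config p {1..n} (X l)"
    and card_X: "\<And>l. l \<le> n \<Longrightarrow> card (X l) = l"
    and X_Suc: "\<And>l. X l \<subseteq> X (Suc l)"
    and alt: "\<And>l. 1 \<le> l \<Longrightarrow> l < n \<Longrightarrow> chain_sign (X l) \<noteq> chain_sign (X (Suc l))"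
    and P_inj: "\<And>l A x y j. l \<le> n \<Longrightarrow> A \<in> P \<Longrightarrow> x \<in> A \<Longrightarrow> y \<in> A \<Longrightarrow> (x, j) \<in> X l \<Longrightarrow> (y, j) \<in> X l \<Longrightarrow> x = y"
    using tucker_partition[OF p _ _ P cardP equivariant_chain_sign] by auto
  have X_mono: "X l \<subseteq> X m" if "l \<le> m" for l m using lift_Suc_mono_le[of X, OF X_Suc that] .
  \<comment> \<open>The number of initial members without a color, equal to \<open>n\<close> if no
    color appears. Members are counted from 1, hence the \<open>Suc\<close>.\<close>
  define B where "B = (LEAST l. n \<le> l \<or> all_colors (X (Suc l)) \<noteq> {})"
  have B: "n \<le> B \<or> all_colors (X (Suc B)) \<noteq> {}"
    unfolding B_def by (rule LeastI[where k = n]) simp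
  have "B \<le> n" unfolding B_def by (rule Least_le) simp
  have bad: "all_colors (X l) = {}" if "1 \<le> l" "l \<le> B" for l
    using not_less_Least[of "l - 1" "\<lambda>l. n \<le> l \<or> all_colors (X (Suc l)) \<noteq> {}"] that
    unfolding B_def[symmetric] by auto
  have good_part: "n - B \<le> (p - 1) * C"
  proof (cases "B < n")
    case True
    have good: "all_colors (X l) \<noteq> {}" if "B < l" for l
      using B True all_colors_mono[OF X_mono[of "Suc B" l]] that by auto
    define m where "m l = Max (all_colors (X l))" for l
    \<comment> \<open>Encodes the largest color and the number of slices attaining it
      lexicographically. Its values lie in 1..C(p - 1), and each sign change increases it.\<close>
    define g where "g l = (m l - 1) * (p - 1) + card (top_colored (X l))" for l
    have m: "1 \<le> m l" "m l \<le> C" if "B < l" for l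
      using Max_in[OF finite_all_colors good[OF that]] all_colors_subset[of "X l"]
      unfolding m_def by auto
    have top_fin: "finite (top_colored (X l))" for l by (simp add: top_colored_def)
    have top_card: "1 \<le> card (top_colored (X l))" "card (top_colored (X l)) \<le> p - 1"
      if "B < l" "l \<le> n" for l
    proof -
      have proper: "top_colored (X l) \<noteq> {}" "top_colored (X l) \<noteq> {..<p}"
        using top_colored_proper[OF X good] that by auto
      then show "1 \<le> card (top_colored (X l))"
        using top_fin[of l] by (simp add: Suc_le_eq card_gt_0_iff)
      have "top_colored (X l) \<subset> {..<p}" using proper by (auto simp: top_colored_def)
      then have "card (top_colored (X l)) < card {..<p}" by (intro psubset_card_mono) auto
      then show "card (top_colored (X l)) \<le> p - 1" by simp
    qed
    have "g l < g (Suc l)" if l: "Suc B \<le> l" "l < n" for l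
    proof -
      have m_le: "m l \<le> m (Suc l)"
        unfolding m_def using all_colors_mono[OF X_Suc] good[of l] l
        by (intro Max_mono finite_all_colors) auto
      show ?thesis
      proof (cases "m l = m (Suc l)")
        case True
        have sub: "top_colored (X l) \<subseteq> top_colored (X (Suc l))"
          using True colors_mono[OF slice_mono[OF X_Suc]] unfolding top_colored_def m_def by auto
        have "chain_sign (X l) = choice p (top_colored (X l))" "chain_sign (X (Suc l)) = choice p (top_colored (X (Suc l)))"
          using good[of l] good[of "Suc l"] l by (auto simp: chain_sign_def)
        then have "top_colored (X l) \<noteq> top_colored (X (Suc l))" using alt[of l] l by auto
        then have "card (top_colored (X l)) < card (top_colored (X (Suc l)))"
          using sub by (intro psubset_card_mono top_fin) auto
        then show ?thesis using True by (simp add: g_def)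
      next
        case False
        then have "m l \<le> m (Suc l) - 1" using m_le by simp
        have "g l \<le> (m l - 1) * (p - 1) + (p - 1)" using top_card[of l] l by (simp add: g_def)
        also have "\<dots> = m l * (p - 1)" using m(1)[of l] l by (cases "m l") auto
        also have "\<dots> \<le> (m (Suc l) - 1) * (p - 1)" by (intro mult_le_mono1) fact
        also have "\<dots> < g (Suc l)" using top_card[of "Suc l"] l by (simp add: g_def)
        finally show ?thesis .
      qed
    qed
    then have "g (Suc B) + (n - Suc B) \<le> g n" using True by (intro strict_increase_le) auto
    moreover have "1 \<le> g (Suc B)" using top_card[of "Suc B"] True by (simp add: g_def)
    moreover have "g n \<le> C * (p - 1)"
    proof -
      have "g n \<le> (m n - 1) * (p - 1) + (p - 1)" using top_card[of n] True by (simp add: g_def)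
      also have "\<dots> = m n * (p - 1)" using m(1)[of n] True by (cases "m n") auto
      also have "\<dots> \<le> C * (p - 1)" using m(2)[of n] True by (intro mult_le_mono1) auto
      finally show ?thesis .
    qed
    ultimately show ?thesis using True by (simp add: mult.commute)
  qed simp
  \<comment> \<open>The bound on \<open>t\<close> is exactly what this inequality requires: p(k - 3)
    + 2 + 2(p - 1) = p(k - 1).\<close>
  have pk: "t + 2 * (p - 1) \<le> p * (k - 1)"
  proof -
    have "k - 1 = k - 3 + 2" using k3 by simp
    then have "p * (k - 1) = p * (k - 3) + p * 2" by (simp only: distrib_left)
    then show ?thesis using t p2 by simp
  qed
  have bad_part: "B \<le> p * (k - 1)"
  proof (cases "B \<le> t")
    case True
    then show ?thesis using pk by simp
  next
    case False
    then have tB: "t < B" by simp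
    show ?thesis
    proof (cases "wide (X B) = {..<p}")
      case True
      have XB: "config p {1..n} (X B)" using X \<open>B \<le> n\<close> tB by simp
      have small: "card (slice (X B) j) \<le> k - 1" if "j < p" for j
      proof (rule wide_small[OF XB])
        show "all_colors (X B) = {}" using bad[of B] tB by simp
        show "j \<in> wide (X B)" using True that by simp
        show "x = y" if "A \<in> P" "x \<in> A" "y \<in> A" "(x, j) \<in> X B" "(y, j) \<in> X B" for A x y
          using P_inj[OF \<open>B \<le> n\<close> that] .
      qed
      have "X B = (\<Union>j<p. slice (X B) j \<times> {j})"
        using XB by (auto simp: config_def slice_def)
      then have "card (X B) \<le> (\<Sum>j<p. card (slice (X B) j \<times> {j}))"
        using card_UN_le[of "{..<p}" "\<lambda>j. slice (X B) j \<times> {j}"] by (simp only: finite_lessThan)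
      also have "\<dots> \<le> (\<Sum>j<p. k - 1)"
        using small by (intro sum_mono) (simp add: card_cartesian_product)
      finally show ?thesis using card_X[OF \<open>B \<le> n\<close>] by simp
    next
      case False
      \<comment> \<open>Width persists along the chain, so before \<open>B\<close> too some slice is
        not wide. The top label then serves as the sign only up to \<open>t\<close> points.\<close>
      have wide_mono: "wide (X l) \<subseteq> wide (X m)" if "l \<le> m" for l m
        using slice_mono[OF X_mono[OF that]] unfolding wide_def by blast
      have not_wide: "wide (X l) \<noteq> {..<p}" if "l \<le> B" for l
        using wide_mono[OF that] False by (auto simp: wide_def)
      have left_mono: "left (X l) \<subseteq> left (X (Suc l))" if "Suc l \<le> n" "1 \<le> l" for l
      proof -
        have "finite (X (Suc l))" "X l \<noteq> {}"
          using config_finite[OF X] X[of l] that by (auto simp: config_def)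
        then have le: "Max (fst ` X l) \<le> Max (fst ` X (Suc l))" using X_Suc[of l] by (intro Max_mono) auto
        show ?thesis
        proof
          fix j assume "j \<in> left (X l)"
          then obtain x where "j < p" "x \<in> slice (X l) j" "x + t \<le> Max (fst ` X l)"
            by (auto simp: left_def)
          moreover from this have "x \<in> slice (X (Suc l)) j" using slice_mono[OF X_Suc] by blast
          ultimately show "j \<in> left (X (Suc l))" using le order_trans unfolding left_def by blast
        qed
      qed
      \<comment> \<open>Values 1..p - 1 belong to the stage of \<open>left\<close>, values p..2(p -
        1) to that of \<open>wide\<close>. Strict growth bounds the members after the first
        \<open>t\<close> by 2(p - 1).\<close>
      define h where "h l = (if left (X l) \<noteq> {..<p} then card (left (X l)) else p - 1 + card (wide (X l)))" for l
      have fin: "finite (left Y)" "finite (wide Y)" for Y by (auto simp: left_def wide_def)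
      have card_proper: "card J \<le> p - 1" if "J \<subseteq> {..<p}" "J \<noteq> {..<p}" for J
        using psubset_card_mono[of "{..<p}" J] psubsetI[OF that] by simp
      have sub: "left Y \<subseteq> {..<p}" "wide Y \<subseteq> {..<p}" for Y by (auto simp: left_def wide_def)
      have sign_eq: "chain_sign (X l) = (if left (X l) \<noteq> {..<p} then choice p (left (X l)) else choice p (wide (X l)))"
        if "t < l" "l \<le> B" for l
        using bad[of l] not_wide[of l] card_X[of l] that \<open>B \<le> n\<close> by (simp add: chain_sign_def)
      have pos: "card (left (X l)) \<ge> 1" "left (X l) = {..<p} \<Longrightarrow> card (wide (X l)) \<ge> 1" if "t < l" "l \<le> B" for l
      proof -
        have Xl: "config p {1..n} (X l)" using X that \<open>B \<le> n\<close> by simp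
        show "card (left (X l)) \<ge> 1"
          using left_nonempty[OF Xl] card_X[of l] that \<open>B \<le> n\<close> fin by (simp add: Suc_le_eq card_gt_0_iff)
        show "card (wide (X l)) \<ge> 1" if "left (X l) = {..<p}"
          using wide_nonempty[OF Xl that] fin by (simp add: Suc_le_eq card_gt_0_iff)
      qed
      have "h l < h (Suc l)" if l: "Suc t \<le> l" "l < B" for l
      proof -
        have ne: "chain_sign (X l) \<noteq> chain_sign (X (Suc l))" using alt[of l] l \<open>B \<le> n\<close> by simp
        have lm: "left (X l) \<subseteq> left (X (Suc l))" using left_mono[of l] l \<open>B \<le> n\<close> by simp
        have wm: "wide (X l) \<subseteq> wide (X (Suc l))" using wide_mono[of l "Suc l"] by simp
        consider "left (X (Suc l)) \<noteq> {..<p}" | "left (X (Suc l)) = {..<p}" "left (X l) \<noteq> {..<p}"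
          | "left (X (Suc l)) = {..<p}" "left (X l) = {..<p}" by blast
        then show ?thesis
        proof cases
          case 1
          then have 2: "left (X l) \<noteq> {..<p}" using lm sub(1)[of "X (Suc l)"] by blast
          have "chain_sign (X l) = choice p (left (X l))" using sign_eq[of l] 2 l by simp
          moreover have "chain_sign (X (Suc l)) = choice p (left (X (Suc l)))" using sign_eq[of "Suc l"] 1 l by simp
          ultimately have "left (X l) \<noteq> left (X (Suc l))" using ne by metis
          then have "card (left (X l)) < card (left (X (Suc l)))"
            using lm fin by (intro psubset_card_mono) auto
          then show ?thesis using 1 2 by (simp add: h_def)
        next
          \<comment> \<open>At the change of stage \<open>h\<close> grows without comparing signs:
            it is at most \<open>p - 1\<close> before and at least \<open>p\<close> after.\<close>
          case 2
          then show ?thesis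
            using card_proper[OF sub(1) 2(2)] pos(2)[of "Suc l"] l by (simp add: h_def)
        next
          case 3
          have "chain_sign (X l) = choice p (wide (X l))" using sign_eq[of l] 3 l by simp
          moreover have "chain_sign (X (Suc l)) = choice p (wide (X (Suc l)))" using sign_eq[of "Suc l"] 3 l by simp
          ultimately have "wide (X l) \<noteq> wide (X (Suc l))" using ne by metis
          then have "card (wide (X l)) < card (wide (X (Suc l)))"
            using wm fin by (intro psubset_card_mono) auto
          then show ?thesis using 3 by (simp add: h_def)
        qed
      qed
      then have "h (Suc t) + (B - Suc t) \<le> h B" using tB by (intro strict_increase_le) auto
      moreover have "1 \<le> h (Suc t)" 
        using pos(1)[of "Suc t"] pos(2)[of "Suc t"] tB unfolding h_def by (simp add: Suc_le_eq)
      moreover have "h B \<le> 2 * (p - 1)"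
        using card_proper[OF sub(1), of "X B"] card_proper[OF sub(2) False]
        by (cases "left (X B) = {..<p}") (simp_all add: h_def)
      ultimately show ?thesis using pk tB by simp
    qed
  qed
  show ?thesis using good_part bad_part by simp
qed

end

section \<open>The chromatic number\<close>

text \<open>Color a set by its minimum: the first \<open>m - 1\<close> colors take intervals of
  \<open>r - 1\<close> points, the last takes the rest. Disjoint sets have distinct minima, so
  \<open>r\<close> of them do not fit into one interval. For the last color, \<open>r\<close>
  disjoint sets would need \<open>r * k\<close> points, but at most \<open>r * k - 1\<close>
  remain.\<close>

lemma KG_wide_coloring_exists:
  assumes r: "r \<ge> 2" and k: "k \<ge> 1" and m: "m \<ge> 1" and n: "n \<le> r * (k - 1) + (r - 1) * m"
  shows "\<exists>c. is_coloring (KG_wide r n k P t) m c"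
proof
  define c where "c \<sigma> = min (Suc ((Min \<sigma> - 1) div (r - 1))) m" for \<sigma> :: "nat set"
  have vert: "finite \<sigma>" "\<sigma> \<noteq> {}" "\<sigma> \<subseteq> {1..n}" "card \<sigma> = k" "Min \<sigma> \<in> \<sigma>"
    if "\<sigma> \<in> KG_wide_verts n k P t" for \<sigma>
  proof -
    show \<sigma>: "\<sigma> \<subseteq> {1..n}" "card \<sigma> = k" using that by (auto simp: KG_wide_verts_def)
    show fin: "finite \<sigma>" using \<sigma>(1) finite_subset by blast
    show ne: "\<sigma> \<noteq> {}" using \<sigma>(2) k by auto
    show "Min \<sigma> \<in> \<sigma>" using fin ne by (rule Min_in)
  qed
  have "\<not> monochromatic c e"
    if e: "e \<subseteq> KG_wide_verts n k P t" "card e = r" "pairwise disjnt e" for e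
  proof
    assume "monochromatic c e"
    then obtain a where a: "\<And>\<sigma>. \<sigma> \<in> e \<Longrightarrow> c \<sigma> = a" by (auto simp: monochromatic_def)
    have v: "\<sigma> \<in> KG_wide_verts n k P t" if "\<sigma> \<in> e" for \<sigma> using e(1) that by blast
    obtain \<tau> where "\<tau> \<in> e" using e(2) r by fastforce
    then have "1 \<le> a" "a \<le> m" using a[of \<tau>] m by (auto simp: c_def)
    show False
    proof (cases "a < m")
      case True
      have "inj_on Min e"
      proof (rule inj_onI, rule ccontr)
        fix \<sigma> \<tau> assume "\<sigma> \<in> e" "\<tau> \<in> e" "Min \<sigma> = Min \<tau>" "\<sigma> \<noteq> \<tau>"
        moreover from this have "disjnt \<sigma> \<tau>" using e(3) by (auto simp: pairwise_def)
        ultimately show False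
          using vert(5)[OF v, of \<sigma>] vert(5)[OF v, of \<tau>] by (auto simp: disjnt_def)
      qed
      moreover have "Min ` e \<subseteq> {(a - 1) * (r - 1) + 1..(a - 1) * (r - 1) + (r - 1)}"
      proof
        fix x assume "x \<in> Min ` e"
        then obtain \<sigma> where \<sigma>: "\<sigma> \<in> e" "x = Min \<sigma>" by auto
        have "x \<ge> 1" using vert(3,5)[OF v[OF \<sigma>(1)]] \<sigma>(2) by auto
        have div: "(x - 1) div (r - 1) = a - 1"
          using a[OF \<sigma>(1)] \<sigma>(2) True by (auto simp: c_def min_def split: if_splits)
        have "(x - 1) mod (r - 1) < r - 1" using r by (intro mod_less_divisor) simp
        moreover have "x - 1 = (a - 1) * (r - 1) + (x - 1) mod (r - 1)"
          using div_mult_mod_eq[of "x - 1" "r - 1"] unfolding div by simp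
        ultimately show "x \<in> {(a - 1) * (r - 1) + 1..(a - 1) * (r - 1) + (r - 1)}"
          using \<open>x \<ge> 1\<close> unfolding atLeastAtMost_iff by linarith
      qed
      then have "card (Min ` e) \<le> card {(a - 1) * (r - 1) + 1..(a - 1) * (r - 1) + (r - 1)}"
        by (intro card_mono) auto
      ultimately show False using e(2) r by (simp add: card_image)
    next
      case False
      then have am: "a = m" using \<open>a \<le> m\<close> by simp
      have "\<Union>e \<subseteq> {(m - 1) * (r - 1) + 1..n}"
      proof
        fix x assume "x \<in> \<Union>e"
        then obtain \<sigma> where \<sigma>: "\<sigma> \<in> e" "x \<in> \<sigma>" by auto
        have "m - 1 \<le> (Min \<sigma> - 1) div (r - 1)"
          using a[OF \<sigma>(1)] am by (auto simp: c_def min_def split: if_splits)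
        then have "(m - 1) * (r - 1) \<le> (Min \<sigma> - 1) div (r - 1) * (r - 1)" by (rule mult_le_mono1)
        also have "\<dots> \<le> Min \<sigma> - 1" by (rule div_times_less_eq_dividend)
        finally have "(m - 1) * (r - 1) \<le> Min \<sigma> - 1" .
        moreover have "1 \<le> Min \<sigma>" using vert(3,5)[OF v[OF \<sigma>(1)]] by auto
        moreover have "Min \<sigma> \<le> x" using vert(1)[OF v[OF \<sigma>(1)]] \<sigma>(2) by (rule Min_le)
        moreover have "x \<le> n" using vert(3)[OF v[OF \<sigma>(1)]] \<sigma>(2) by auto
        ultimately show "x \<in> {(m - 1) * (r - 1) + 1..n}" unfolding atLeastAtMost_iff by linarith
      qed
      then have "card (\<Union>e) \<le> n - (m - 1) * (r - 1)"
        using card_mono[of "{(m - 1) * (r - 1) + 1..n}" "\<Union>e"] by simp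
      moreover have "card (\<Union>e) = r * k"
      proof -
        have "card (\<Union>e) = sum card e"
          using e(3) vert(1)[OF v] by (intro card_Union_disjoint) auto
        also have "\<dots> = r * k" using vert(4)[OF v] e(2) by simp
        finally show ?thesis .
      qed
      moreover have "(r - 1) * m = (m - 1) * (r - 1) + (r - 1)" using m by (cases m) auto
      moreover have "r * k = r * (k - 1) + r" using k by (cases k) auto
      ultimately show False using n r by linarith
    qed
  qed
  then show "is_coloring (KG_wide r n k P t) m c"
    using m by (auto simp: is_coloring_def KG_wide_def c_def)
qed

theorem theorem5p1:
  fixes k r n t :: nat and P :: "nat set set"
  assumes "k \<ge> 1"
    and "r \<ge> 2" and "prime r"
    and "n \<ge> r * k"
    and "partition_on {1..n} P"
    and "\<forall>p\<in>P. card p \<le> r - 1"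
    and "t \<ge> 1"
    and "int t \<le> int r * (int k - 3) + 2"
  shows "int (chromatic_number (KG_wide r n k P t)) =
    \<lceil>(real n - real r * (real k - 1)) / (real r - 1)\<rceil>"
proof -
  \<comment> \<open>For smaller \<open>k\<close> the bound on \<open>t\<close> would be at most 2 -
    r, contradicting \<open>t \<ge> 1\<close>. Hence truncated subtraction in \<open>k - 3\<close>
    is harmless below.\<close>
  have k3: "k \<ge> 3"
  proof (rule ccontr)
    assume "\<not> k \<ge> 3"
    then have "int r * (int k - 3) \<le> int r * (- 1)" by (intro mult_left_mono) auto
    then show False using assms(2,7,8) by simp
  qed
  have "int (r * (k - 3) + 2) = int r * (int k - 3) + 2" using k3 by (simp add: of_nat_diff)
  then have t: "t \<le> r * (k - 3) + 2" using assms(8) by linarith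
  have n1: "n \<ge> 1" using assms(4) k3 assms(2) by (cases n) auto
  let ?x = "(real n - real r * (real k - 1)) / (real r - 1)"
  have r1: "real r - 1 > 0" using assms(2) by simp
  have x_le: "?x \<le> real C \<longleftrightarrow> n \<le> r * (k - 1) + (r - 1) * C" for C
  proof -
    have "?x \<le> real C \<longleftrightarrow> real n \<le> real r * (real k - 1) + (real r - 1) * real C"
      using r1 by (simp add: divide_le_eq algebra_simps)
    also have "real r * (real k - 1) + (real r - 1) * real C = real (r * (k - 1) + (r - 1) * C)"
      using assms(1,2) by (simp add: of_nat_diff)
    finally show ?thesis by (simp only: of_nat_le_iff)
  qed
  define m where "m = nat \<lceil>?x\<rceil>"
  have "real (r * k) \<le> real n" using assms(4) by (simp only: of_nat_le_iff)
  \<comment> \<open>The numerator is at least \<open>r\<close> because \<open>n \<ge> r * k\<close>,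
    so \<open>m\<close> is a positive number of colors.\<close>
  then have "?x > 0" using r1 assms(2) by (intro divide_pos_pos) (auto simp: algebra_simps)
  then have m: "int m = \<lceil>?x\<rceil>" "m \<ge> 1" unfolding m_def by linarith+
  have "\<exists>c. is_coloring (KG_wide r n k P t) m c"
  proof (rule KG_wide_coloring_exists[OF assms(2,1) m(2)])
    have "?x \<le> real m" using m(1) le_of_int_ceiling[of ?x] by (metis of_int_of_nat_eq)
    then show "n \<le> r * (k - 1) + (r - 1) * m" by (simp only: x_le)
  qed
  moreover have "m \<le> C" if "\<exists>c. is_coloring (KG_wide r n k P t) C c" for C
  proof -
    from that obtain c where "is_coloring (KG_wide r n k P t) C c" by blast
    then interpret wide_coloring r n k t C P c
      using assms(3,5,6) k3 by unfold_locales auto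
    have "n \<le> r * (k - 1) + (r - 1) * C" by (rule wide_coloring_bound[OF t k3 n1])
    then have "?x \<le> real C" by (simp only: x_le)
    then show ?thesis unfolding m_def by (simp add: ceiling_le_iff)
  qed
  ultimately have "chromatic_number (KG_wide r n k P t) = m"
    unfolding chromatic_number_def by (rule Least_equality)
  then show ?thesis using m(1) by simp
qed

end
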